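(* Let $K\subset\mathbb R^n$, $n\geqslant3$, be a zero-dimensional compact set. Suppose that for some $m$-plane $\Pi\subset\mathbb R^n$, where $1\leqslant m\leqslant n$, there exists a countable family of subsets $X_1,X_2,\ldots\subset\Pi$ such that each $X_i$ is a flat cell in $\Pi$, $\dim X_i\leqslant m-1$, and $p_\Pi(K)\subset X_1\cup X_2\cup\ldots$. Then $K$ is tame in $\mathbb R^n$.
   Context: An $m$-plane in $\mathbb R^n$ is an $m$-dimensional affine subspace; $p_\Pi:\mathbb R^n\to\Pi$ is the orthogonal projection onto $\Pi$. $\dim$ is topological (covering) dimension. A $k$-cell is any set homeomorphic to a closed ball in $\mathbb R^k$. A $k$-cell $X\subset\mathbb R^m$ is called flat if there exists a homeomorphism $h$ of $\mathbb R^m$ onto itself such that $h(X)$ is a $k$-simplex; flatness in an $m$-plane $\Pi$ is understood by identifying $\Pi$ with $\mathbb R^m$. A zero-dimensional compact set $K\subset\mathbb R^n$ is called tame if there exists a homeomorphism $h$ of $\mathbb R^n$ onto itself such that $h(K)$ is a subset of a straight line in $\mathbb R^n$. *)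

theory Defs
  imports "HOL-Analysis.Analysis"
begin

section \<open>Covering dimension\<close>

text \<open>Every finite open cover has a finite open refinement of order at most \<open>d\<close>, i.e. every
  point lies in at most \<open>d + 1\<close> of its members. For \<open>d = -1\<close> this says that the space is empty.\<close>

definition covering_dim_le :: "'a topology \<Rightarrow> int \<Rightarrow> bool" where
  "covering_dim_le T d \<longleftrightarrow>
     (\<forall>\<U>. finite \<U> \<and> (\<forall>U\<in>\<U>. openin T U) \<and> \<Union>\<U> = topspace T \<longrightarrow>
        (\<exists>\<V>. finite \<V> \<and> (\<forall>V\<in>\<V>. openin T V \<and> (\<exists>U\<in>\<U>. V \<subseteq> U)) \<and> \<Union>\<V> = topspace T \<and>
             (\<forall>x\<in>topspace T. int (card {V\<in>\<V>. x \<in> V}) \<le> d + 1)))"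

text \<open>Values are \<open>-1\<close> (exactly for the empty space), \<open>0, 1, 2, \<dots>\<close> or \<open>\<infinity>\<close>.\<close>

definition covering_dim :: "'a topology \<Rightarrow> ereal" where
  "covering_dim T = Inf {ereal (of_int d) | d. - 1 \<le> d \<and> covering_dim_le T d}"

lemma covering_dim_le_mono:
  assumes "covering_dim_le T d" "d \<le> e"
  shows "covering_dim_le T e"
  unfolding covering_dim_le_def
proof (intro allI impI, goal_cases)
  case (1 \<U>)
  from assms(1)[unfolded covering_dim_le_def, THEN spec, THEN mp, OF 1]
  show ?case
  proof (rule ex_forward, elim conjE, intro conjI)
    fix \<V> assume "\<forall>x\<in>topspace T. int (card {V\<in>\<V>. x \<in> V}) \<le> d + 1"
    then show "\<forall>x\<in>topspace T. int (card {V\<in>\<V>. x \<in> V}) \<le> e + 1"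
      using assms(2) by (meson add_right_mono order_trans)
  qed
qed

lemma covering_dim_le_iff:
  assumes "- 1 \<le> d"
  shows "covering_dim T \<le> ereal (of_int d) \<longleftrightarrow> covering_dim_le T d"
proof
  assume "covering_dim_le T d"
  then show "covering_dim T \<le> ereal (of_int d)"
    unfolding covering_dim_def using assms by (intro Inf_lower) blast
next
  assume "covering_dim T \<le> ereal (of_int d)"
  also have "\<dots> < ereal (real_of_int (d + 1))" by simp
  finally obtain e where "covering_dim_le T e" "ereal (of_int e) < ereal (real_of_int (d + 1))"
    unfolding covering_dim_def Inf_less_iff by blast
  then show "covering_dim_le T d" by (auto intro: covering_dim_le_mono)
qed

lemma covering_dim_le_neg1_iff: "covering_dim_le T (- 1) \<longleftrightarrow> topspace T = {}"
proof
  assume "covering_dim_le T (- 1)"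
  note * = this[unfolded covering_dim_le_def, THEN spec[of _ "{topspace T}"], THEN mp]
  have "\<exists>\<V>. finite \<V> \<and> (\<forall>V\<in>\<V>. openin T V \<and> (\<exists>U\<in>{topspace T}. V \<subseteq> U)) \<and>
      \<Union>\<V> = topspace T \<and> (\<forall>x\<in>topspace T. int (card {V\<in>\<V>. x \<in> V}) \<le> - 1 + 1)"
    by (rule *) simp
  then obtain \<V> where \<V>: "finite \<V>" "\<Union>\<V> = topspace T"
      "\<forall>x\<in>topspace T. int (card {V\<in>\<V>. x \<in> V}) \<le> - 1 + 1"
    by (elim exE conjE)
  then have "{V\<in>\<V>. x \<in> V} = {}" if "x \<in> topspace T" for x
    using that by simp
  then show "topspace T = {}" using \<V>(2) by blast
next
  assume "topspace T = {}"
  then show "covering_dim_le T (- 1)"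
    unfolding covering_dim_le_def by (intro allI impI exI[of _ "{}"]) simp
qed


section \<open>Orthogonal projection onto a plane\<close>

definition orthogonal_projection :: "'a::euclidean_space set \<Rightarrow> 'a \<Rightarrow> 'a" where
  "orthogonal_projection P x = (THE y. y \<in> P \<and> (\<forall>z\<in>P. orthogonal (x - y) (z - y)))"

lemma orthogonal_projection_eq_closest_point:
  fixes P :: "'a::euclidean_space set"
  assumes "affine P" "P \<noteq> {}"
  shows "orthogonal_projection P x = closest_point P x"
  unfolding orthogonal_projection_def
proof (rule the_equality)
  let ?c = "closest_point P x"
  have cl: "closed P" and cv: "convex P"
    using assms by (auto simp: affine_closed affine_imp_convex)
  have c: "?c \<in> P" by (simp add: assms cl closest_point_in_set)
  show "?c \<in> P \<and> (\<forall>z\<in>P. orthogonal (x - ?c) (z - ?c))"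
  proof (intro conjI ballI)
    fix z assume z: "z \<in> P"
    have "2 *\<^sub>R ?c + (- 1) *\<^sub>R z \<in> P" using assms(1) c z by (intro mem_affine) auto
    from closest_point_dot[OF cv cl this, of x] closest_point_dot[OF cv cl z, of x]
    show "orthogonal (x - ?c) (z - ?c)"
      by (simp add: orthogonal_def inner_diff_right inner_add_right)
  qed (rule c)
  fix y assume y: "y \<in> P \<and> (\<forall>z\<in>P. orthogonal (x - y) (z - y))"
  have "dist x y \<le> dist x z" if "z \<in> P" for z
  proof -
    have "orthogonal (x - y) (y - z)"
      using y that by (metis minus_diff_eq orthogonal_clauses(3))
    then have "norm (x - z) ^ 2 = norm (x - y) ^ 2 + norm (y - z) ^ 2"
      using norm_add_Pythagorean[of "x - y" "y - z"] by simp
    then have "norm (x - y) ^ 2 \<le> norm (x - z) ^ 2" by simp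
    then show ?thesis by (simp add: dist_norm)
  qed
  then show "y = ?c" using y closest_point_unique[OF cv cl] by blast
qed


section \<open>Flat cells and tame sets\<close>

definition cell :: "nat \<Rightarrow> 'a::topological_space set \<Rightarrow> bool" where
  "cell k X \<longleftrightarrow>
     top_of_set X homeomorphic_space subtopology (Euclidean_space k) {x. (\<Sum>i<k. (x i)\<^sup>2) \<le> 1}"

text \<open>An \<open>m\<close>-plane is identified with \<open>m\<close>-space by an affine isomorphism; as this preserves
  simplices and homeomorphisms, flatness is expressed by self-homeomorphisms of the plane itself.\<close>

definition flat_cell_in :: "'a::euclidean_space set \<Rightarrow> 'a set \<Rightarrow> bool" where
  "flat_cell_in P X \<longleftrightarrow>
     X \<subseteq> P \<and> (\<exists>k. cell k X \<and> (\<exists>h h'. homeomorphism P P h h' \<and> int k simplex h ` X))"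

definition tame :: "'a::euclidean_space set \<Rightarrow> bool" where
  "tame K \<longleftrightarrow>
     compact K \<and> covering_dim (top_of_set K) = 0 \<and>
     (\<exists>h h'. homeomorphism (UNIV :: 'a set) (UNIV :: 'a set) h h' \<and> (\<exists>L. affine L \<and> aff_dim L = 1 \<and> h ` K \<subseteq> L))"

end

(* Cut K into the countably many compact pieces lying over the cells X. A self-homeomorphism of
   the plane carrying X onto a simplex extends along the projection to the whole space. By
   Lebesgue's covering theorem the simplex has dimension less than m, so the piece over X is
   carried into a hyperplane, where zero-dimensionality lets one enclose it in disjoint small
   open sets inside which homeomorphisms compress it arbitrarily ("shrinkable").

   By Baire's theorem, a generic homeomorphism h at bounded distance from the identity makes the
   height function x |-> e . h x injective on K: it suffices to separate the heights of countably
   many pairs of disjoint compact subsets of the pieces, which is an open condition, and a dense one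
   because disjoint shrinkable sets can be compressed into tiny balls of distinct heights. A compact
   set with injective height function is sheared into a line. *)

theory Submission
  imports Defs
begin

section \<open>Shrinkable sets\<close>

text \<open>The obstacle is wildness: the small clopen parts of a zero-dimensional compact set are
  disjoint, yet, as for Antoine's necklace in 3-space, it may be impossible to enclose them in
  disjoint small open cells. A hyperplane leaves a spare normal direction along which the parts can
  be lifted away from each other, and the dimension bound on the cells serves to reach one. A second
  obstacle is that pieces over different cells may meet and accumulate on each other, so that good
  neighbourhoods of the single pieces do not combine into neighbourhoods of the union. Injectivity
  of the height avoids this: it splits into countably many conditions, each on two disjoint compact
  sets that lie in at most two pieces (possibly in the same one). Disjoint shrinkable compact sets
  do combine, and shrinkability passes to subsets and to images under homeomorphisms of the space,
  so every such condition can be treated after any homeomorphism already performed.\<close>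

lemma homeomorphism_UNIV_iff:
  "homeomorphism UNIV UNIV f g \<longleftrightarrow>
     continuous_on UNIV f \<and> continuous_on UNIV g \<and> (\<forall>x. g (f x) = x) \<and> (\<forall>x. f (g x) = x)"
  unfolding homeomorphism_def by (auto intro: surjI) (metis rangeI)+

text \<open>By compactness \<open>Q\<close> keeps a positive distance from the boundary sphere, so
  it lies in a concentric ball of radius \<open>q < r\<close>. Multiplying the radius by a high
  power of its ratio to \<open>r\<close> makes that smaller ball tiny and fixes everything from
  radius \<open>r\<close> on.\<close>

lemma shrink_ball_radially:
  fixes c :: "'a::euclidean_space"
  assumes "0 < r" "compact Q" "Q \<subseteq> ball c r" "0 < d"
  obtains g g' where "homeomorphism UNIV UNIV g g'" "\<And>x. x \<notin> ball c r \<Longrightarrow> g x = x"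
    "g ` Q \<subseteq> ball c d"
proof -
  obtain q where q: "0 \<le> q" "q < r" "Q \<subseteq> cball c q"
  proof (cases "Q = {}")
    case False
    have "continuous_on Q (dist c)" by (intro continuous_intros)
    then obtain x where "x \<in> Q" "\<forall>y\<in>Q. dist c y \<le> dist c x"
      using continuous_attains_sup[OF \<open>compact Q\<close> False] by blast
    moreover from this have "Q \<subseteq> cball c (dist c x)" by auto
    ultimately show ?thesis using that[of "dist c x"] assms(3) by auto
  qed (use that[of 0] \<open>0 < r\<close> in auto)
  have "(\<lambda>n. (q / r) ^ n * r) \<longlonglongrightarrow> 0 * r"
    using q \<open>0 < r\<close> by (intro tendsto_mult tendsto_const LIMSEQ_power_zero) auto
  then have "\<forall>\<^sub>F n in sequentially. (q / r) ^ n * r < d"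
    using \<open>0 < d\<close> by (intro order_tendstoD(2)) auto
  then obtain n where n: "(q / r) ^ n * r < d"
    by (auto simp: eventually_sequentially)
  \<comment> \<open>The exponent \<open>n\<close> was chosen so that radii up to \<open>q\<close>
    become smaller than \<open>d\<close>. The cap at 1 makes the map the identity outside the
    ball.\<close>
  define k where "k t = (min 1 (t / r)) ^ n" for t
  define g where "g x = c + k (norm (x - c)) *\<^sub>R (x - c)" for x
  have k0: "0 < k t" if "0 < t" for t using that \<open>0 < r\<close> by (simp add: k_def)
  have kge: "0 \<le> k t" if "0 \<le> t" for t using that \<open>0 < r\<close> by (simp add: k_def)
  have kmono: "k s \<le> k t" if "0 \<le> s" "s \<le> t" for s t
  proof -
    have "s / r \<le> t / r" "0 \<le> s / r" using that \<open>0 < r\<close> by (auto simp: divide_right_mono)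
    then show ?thesis unfolding k_def by (intro power_mono) auto
  qed
  have contk: "continuous_on UNIV k"
    unfolding k_def by (intro continuous_intros) (use \<open>0 < r\<close> in auto)
  have cont: "continuous_on UNIV g"
    unfolding g_def
    by (intro continuous_intros continuous_on_compose2[OF contk]) auto
  have ng: "norm (g x - c) = k (norm (x - c)) * norm (x - c)" for x
    by (simp add: g_def kge)
  have strict: "k s * s < k t * t" if "0 \<le> s" "s < t" for s t
    using that kmono[of s t] k0[of t] kge[of s]
    by (smt (verit) mult_left_mono mult_right_mono mult_strict_left_mono)
  have "inj g"
  proof (rule injI)
    fix x y assume eq: "g x = g y"
    then have "norm (x - c) = norm (y - c)"
      using ng[of x] ng[of y] strict[of "norm (x - c)" "norm (y - c)"]
        strict[of "norm (y - c)" "norm (x - c)"]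
      by (metis linorder_neqE_linordered_idom norm_ge_zero order_less_irrefl)
    with eq have "k (norm (x - c)) *\<^sub>R (x - c) = k (norm (x - c)) *\<^sub>R (y - c)"
      by (simp add: g_def)
    then show "x = y"
      using k0[of "norm (x - c)"] \<open>norm (x - c) = norm (y - c)\<close> by (cases "x = c") force+
  qed
  have "surj g"
  proof (unfold surj_def, intro allI)
    fix y
    let ?s = "norm (y - c)"
    show "\<exists>x. y = g x"
    proof (cases "y = c")
      case False
      have "k (max ?s r) = 1" using \<open>0 < r\<close> by (simp add: k_def min_def field_simps)
      then have "\<exists>t. 0 \<le> t \<and> t \<le> max ?s r \<and> k t * t = ?s"
        using \<open>0 < r\<close>
        by (intro IVT') (auto intro!: continuous_intros continuous_on_subset[OF contk] simp: max_def)
      then obtain t where t: "0 \<le> t" "k t * t = ?s" by blast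
      have "norm ((t / ?s) *\<^sub>R (y - c)) = t" using False t by simp
      then have "g (c + (t / ?s) *\<^sub>R (y - c)) = c + k t *\<^sub>R (t / ?s) *\<^sub>R (y - c)"
        by (simp add: g_def)
      also have "\<dots> = y" using False t by simp
      finally show ?thesis by metis
    qed (auto intro!: exI[of _ c] simp: g_def)
  qed
  \<comment> \<open>Invariance of domain supplies continuity of the inverse, which has no convenient
    formula.\<close>
  obtain g' where "homeomorphism UNIV (range g) g g'"
    using invariance_of_domain_homeomorphism[OF open_UNIV cont _ \<open>inj g\<close>] by auto
  then have hom: "homeomorphism UNIV UNIV g g'" using \<open>surj g\<close> by simp
  show ?thesis
  proof (rule that[OF hom])
    show "g x = x" if "x \<notin> ball c r" for x
      using that \<open>0 < r\<close> by (simp add: g_def k_def dist_norm norm_minus_commute min_def)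
    show "g ` Q \<subseteq> ball c d"
    proof clarify
      fix x assume "x \<in> Q"
      then have "norm (x - c) \<le> q" using q(3) by (auto simp: dist_norm norm_minus_commute)
      then have "k (norm (x - c)) * norm (x - c) \<le> k q * r"
        using kmono[of "norm (x - c)" q] q kge[of "norm (x - c)"] by (intro mult_mono) auto
      also have "k q = (q / r) ^ n" using q by (simp add: k_def min_def)
      finally show "g x \<in> ball c d"
        using n ng[of x] by (simp add: dist_norm norm_minus_commute)
    qed
  qed
qed

text \<open>The target \<open>V\<close> is an arbitrary open set and not a small ball: this makes
  the notion invariant under homeomorphisms of the space, and lets the place of compression be
  chosen later, when the heights are prescribed.\<close>

definition compressible_in :: "'a::euclidean_space set \<Rightarrow> 'a set \<Rightarrow> bool" where
  "compressible_in U C \<longleftrightarrow>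
     (\<forall>V. open V \<and> V \<noteq> {} \<and> V \<subseteq> U \<longrightarrow>
        (\<exists>g g'. homeomorphism UNIV UNIV g g' \<and> (\<forall>x. x \<notin> U \<longrightarrow> g x = x) \<and> g ` (C \<inter> U) \<subseteq> V))"

lemma compressible_in_mono:
  assumes "compressible_in U D" "C \<inter> U \<subseteq> D"
  shows "compressible_in U C"
proof -
  have "C \<inter> U \<subseteq> D \<inter> U" using assms(2) by blast
  then have "g ` (C \<inter> U) \<subseteq> g ` (D \<inter> U)" for g :: "'a \<Rightarrow> 'a" by (rule image_mono)
  then show ?thesis using assms(1) unfolding compressible_in_def by (meson order_trans)
qed

text \<open>A homeomorphism \<open>f\<close> supported in the ball moves the centre into
  \<open>V\<close>. Compressing \<open>Q\<close> radially into a small ball about the centre that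
  \<open>f\<close> sends into \<open>V\<close>, and then applying \<open>f\<close>, gives the
  map.\<close>

lemma compressible_in_ball:
  fixes c :: "'a::euclidean_space"
  assumes "compact Q" "Q \<subseteq> ball c r"
  shows "compressible_in (ball c r) Q"
  unfolding compressible_in_def
proof (intro allI impI, elim conjE)
  fix V assume V: "open V" "V \<noteq> {}" "V \<subseteq> ball c r"
  then obtain p where p: "p \<in> V" "p \<in> ball c r" by blast
  then have "0 < r" by (metis ball_eq_empty empty_iff linorder_not_le)
  obtain f f' where f: "homeomorphism UNIV UNIV f f'" "f c = p"
      "{x. \<not> (f x = x \<and> f' x = x)} \<subseteq> ball c r \<inter> UNIV"
    using homeomorphism_moving_point_3[of UNIV c r UNIV c p] p \<open>0 < r\<close> by auto
  have cf: "continuous_on UNIV f" using f(1) by (simp add: homeomorphism_def)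
  have "open (f -` V)" using cf V(1) by (simp add: continuous_on_open_vimage)
  moreover have "c \<in> f -` V" using f(2) p by simp
  ultimately obtain d where d: "0 < d" "ball c d \<subseteq> f -` V" by (meson open_contains_ball)
  obtain g g' where g: "homeomorphism UNIV UNIV g g'" "\<And>x. x \<notin> ball c r \<Longrightarrow> g x = x"
      "g ` Q \<subseteq> ball c d"
    using shrink_ball_radially[OF \<open>0 < r\<close> assms \<open>0 < d\<close>] by metis
  show "\<exists>g g'. homeomorphism UNIV UNIV g g' \<and> (\<forall>x. x \<notin> ball c r \<longrightarrow> g x = x) \<and>
      g ` (Q \<inter> ball c r) \<subseteq> V"
  proof (intro exI conjI allI impI)
    show "homeomorphism UNIV UNIV (f \<circ> g) (g' \<circ> f')"
      using g(1) f(1) by (rule homeomorphism_compose)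
    show "(f \<circ> g) x = x" if "x \<notin> ball c r" for x using g(2)[OF that] f(3) that by auto
    show "(f \<circ> g) ` (Q \<inter> ball c r) \<subseteq> V" using g(3) d(2) by auto
  qed
qed

lemma compressible_in_homeomorphic_image:
  assumes h: "homeomorphism UNIV UNIV h h'" and "compressible_in U C"
  shows "compressible_in (h ` U) (h ` C)"
  unfolding compressible_in_def
proof (intro allI impI, elim conjE)
  have h': "continuous_on UNIV h" "\<And>x. h' (h x) = x" "\<And>x. h (h' x) = x"
    using h by (auto simp: homeomorphism_UNIV_iff)
  fix V assume V: "open V" "V \<noteq> {}" "V \<subseteq> h ` U"
  have "open (h -` V)" using h'(1) V(1) by (simp add: continuous_on_open_vimage)
  moreover have "h -` V \<noteq> {}" using V(2,3) by blast
  moreover have "h -` V \<subseteq> U"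
  proof
    fix x assume "x \<in> h -` V"
    then obtain u where "u \<in> U" "h x = h u" using V(3) by blast
    then show "x \<in> U" by (metis h'(2))
  qed
  ultimately obtain g g' where g: "homeomorphism UNIV UNIV g g'" "\<forall>x. x \<notin> U \<longrightarrow> g x = x"
      "g ` (C \<inter> U) \<subseteq> h -` V"
    using assms(2)[unfolded compressible_in_def, rule_format, of "h -` V"] by meson
  show "\<exists>g g'. homeomorphism UNIV UNIV g g' \<and> (\<forall>x. x \<notin> h ` U \<longrightarrow> g x = x) \<and>
      g ` (h ` C \<inter> h ` U) \<subseteq> V"
  proof (intro exI conjI allI impI)
    show "homeomorphism UNIV UNIV (h \<circ> g \<circ> h') (h \<circ> g' \<circ> h')"
      using homeomorphism_compose[OF homeomorphism_compose[OF homeomorphism_symD[OF h] g(1)] h]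
      by (simp only: comp_assoc)
    show "(h \<circ> g \<circ> h') x = x" if "x \<notin> h ` U" for x
    proof -
      have "h' x \<notin> U" using that h'(3) by (metis image_eqI)
      then show ?thesis using g(2) h'(3) by simp
    qed
    show "(h \<circ> g \<circ> h') ` (h ` C \<inter> h ` U) \<subseteq> V"
    proof
      fix z assume "z \<in> (h \<circ> g \<circ> h') ` (h ` C \<inter> h ` U)"
      then obtain x y where xy: "x \<in> C" "y \<in> U" "h x = h y" "z = h (g (h' (h x)))" by auto
      then have "x = y" by (metis h'(2))
      then have "g x \<in> h -` V" using xy g(3) by blast
      then show "z \<in> V" using xy(4) by (simp add: h'(2))
    qed
  qed
qed

text \<open>Every member must meet \<open>C\<close>, so that the neighbourhoods stay within
  \<epsilon> of \<open>C\<close>. Uniform continuity on a bounded set, and the distance between two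
  disjoint compact sets, can then be used.\<close>

definition shrinkable :: "'a::euclidean_space set \<Rightarrow> bool" where
  "shrinkable C \<longleftrightarrow>
     (\<forall>\<epsilon>>0. \<exists>\<U>. finite \<U> \<and> disjoint \<U> \<and> C \<subseteq> \<Union>\<U> \<and>
        (\<forall>U\<in>\<U>. open U \<and> C \<inter> U \<noteq> {} \<and> (\<forall>x\<in>U. \<forall>y\<in>U. dist x y < \<epsilon>) \<and> compressible_in U C))"

lemma shrinkable_subset:
  assumes "shrinkable D" "C \<subseteq> D"
  shows "shrinkable C"
  unfolding shrinkable_def
proof (intro allI impI)
  fix \<epsilon> :: real assume "\<epsilon> > 0"
  then obtain \<U> where \<U>: "finite \<U>" "disjoint \<U>" "D \<subseteq> \<Union>\<U>"
      "\<And>U. U \<in> \<U> \<Longrightarrow> open U \<and> (\<forall>x\<in>U. \<forall>y\<in>U. dist x y < \<epsilon>) \<and> compressible_in U D"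
    using assms(1) unfolding shrinkable_def by meson
  show "\<exists>\<U>. finite \<U> \<and> disjoint \<U> \<and> C \<subseteq> \<Union>\<U> \<and>
        (\<forall>U\<in>\<U>. open U \<and> C \<inter> U \<noteq> {} \<and> (\<forall>x\<in>U. \<forall>y\<in>U. dist x y < \<epsilon>) \<and> compressible_in U C)"
  proof (intro exI[of _ "{U \<in> \<U>. C \<inter> U \<noteq> {}}"] conjI ballI)
    show "disjoint {U \<in> \<U>. C \<inter> U \<noteq> {}}" using \<U>(2) by (rule pairwise_subset) auto
    show "C \<subseteq> \<Union> {U \<in> \<U>. C \<inter> U \<noteq> {}}" using \<U>(3) assms(2) by blast
    fix U assume U: "U \<in> {U \<in> \<U>. C \<inter> U \<noteq> {}}"
    then show "open U" "C \<inter> U \<noteq> {}" "\<And>x y. x \<in> U \<Longrightarrow> y \<in> U \<Longrightarrow> dist x y < \<epsilon>" using \<U>(4) by auto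
    show "compressible_in U C" using U \<U>(4) assms(2) by (blast intro: compressible_in_mono)
  qed (use \<U>(1) in auto)
qed

text \<open>\<open>h\<close> need not be uniformly continuous on the whole space. Neighbourhoods of
  diameter below 1 that meet \<open>C\<close> stay in a fixed ball of radius \<open>R + 1\<close>,
  where it is.\<close>

lemma shrinkable_homeomorphic_image:
  assumes "shrinkable C" "compact C" and h: "homeomorphism UNIV UNIV h h'"
  shows "shrinkable (h ` C)"
  unfolding shrinkable_def
proof (intro allI impI)
  have h': "continuous_on UNIV h" "\<And>x. h' (h x) = x" "\<And>x. h (h' x) = x"
    using h by (auto simp: homeomorphism_UNIV_iff)
  fix \<epsilon> :: real assume "\<epsilon> > 0"
  obtain R where R: "C \<subseteq> cball 0 R"
    using compact_imp_bounded[OF \<open>compact C\<close>] by (auto simp: bounded_iff subset_iff)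
  have "uniformly_continuous_on (cball 0 (R + 1)) h"
    by (intro compact_uniformly_continuous continuous_on_subset[OF h'(1)]) auto
  then obtain \<delta> where \<delta>: "\<delta> > 0"
      "\<And>x y. x \<in> cball 0 (R + 1) \<Longrightarrow> y \<in> cball 0 (R + 1) \<Longrightarrow> dist x y < \<delta> \<Longrightarrow> dist (h x) (h y) < \<epsilon>"
    using \<open>\<epsilon> > 0\<close> unfolding uniformly_continuous_on_def by (metis dist_commute)
  obtain \<U> where \<U>: "finite \<U>" "disjoint \<U>" "C \<subseteq> \<Union>\<U>"
      "\<And>U. U \<in> \<U> \<Longrightarrow> open U \<and> C \<inter> U \<noteq> {} \<and> (\<forall>x\<in>U. \<forall>y\<in>U. dist x y < min 1 \<delta>) \<and> compressible_in U C"
    using assms(1)[unfolded shrinkable_def, rule_format, of "min 1 \<delta>"] \<delta>(1) by auto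
  have sub: "U \<subseteq> cball 0 (R + 1)" if U: "U \<in> \<U>" for U
  proof
    fix x assume "x \<in> U"
    obtain y where y: "y \<in> C" "y \<in> U" using \<U>(4)[OF U] by blast
    then have "dist x y < 1" using \<U>(4)[OF U] \<open>x \<in> U\<close> by auto
    moreover have "norm y \<le> R" using y R by auto
    ultimately show "x \<in> cball 0 (R + 1)"
      using norm_triangle_sub[of x y] by (simp add: dist_norm)
  qed
  have "inj h" using h'(2) by (metis injI)
  show "\<exists>\<U>. finite \<U> \<and> disjoint \<U> \<and> h ` C \<subseteq> \<Union>\<U> \<and>
        (\<forall>U\<in>\<U>. open U \<and> h ` C \<inter> U \<noteq> {} \<and> (\<forall>x\<in>U. \<forall>y\<in>U. dist x y < \<epsilon>) \<and> compressible_in U (h ` C))"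
  proof (intro exI[of _ "(`) h ` \<U>"] conjI ballI)
    show "disjoint ((`) h ` \<U>)"
    proof (rule pairwiseI)
      fix A B assume "A \<in> (`) h ` \<U>" "B \<in> (`) h ` \<U>" "A \<noteq> B"
      then obtain U W where UW: "U \<in> \<U>" "W \<in> \<U>" "U \<noteq> W" "A = h ` U" "B = h ` W" by blast
      then have "U \<inter> W = {}" using \<U>(2) by (metis disjnt_def pairwiseD)
      then show "disjnt A B" using UW image_Int[OF \<open>inj h\<close>, of U W] by (simp add: disjnt_def)
    qed
    show "h ` C \<subseteq> \<Union> ((`) h ` \<U>)" using \<U>(3) by blast
    fix W assume "W \<in> (`) h ` \<U>"
    then obtain U where U: "U \<in> \<U>" "W = h ` U" by blast
    show "open W"
      using U \<U>(4) h by (metis homeomorphism_imp_open_map open_openin subtopology_UNIV)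
    show "h ` C \<inter> W \<noteq> {}" using U \<U>(4) by blast
    show "compressible_in W (h ` C)"
      using U \<U>(4) compressible_in_homeomorphic_image[OF h] by blast
    fix x y assume "x \<in> W" "y \<in> W"
    then obtain x' y' where "x' \<in> U" "y' \<in> U" "x = h x'" "y = h y'" using U by blast
    then show "dist x y < \<epsilon>" using \<U>(4)[OF U(1)] \<delta>(2)[of x' y'] subsetD[OF sub[OF U(1)]] by simp
  qed (use \<U>(1) in auto)
qed

text \<open>If \<open>d\<close> bounds the distance of \<open>C\<close> from \<open>D\<close> below,
  then members of diameter below \<open>d / 2\<close> that meet \<open>C\<close> are disjoint from
  such members that meet \<open>D\<close>. Each member then sees only one of the two sets, and its
  compression serves the union.\<close>

lemma shrinkable_Un:
  assumes "shrinkable C" "shrinkable D" "compact C" "compact D" "C \<inter> D = {}"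
  shows "shrinkable (C \<union> D)"
  unfolding shrinkable_def
proof (intro allI impI)
  fix \<epsilon> :: real assume "\<epsilon> > 0"
  obtain d where d: "d > 0" "\<And>x y. x \<in> C \<Longrightarrow> y \<in> D \<Longrightarrow> d \<le> dist x y"
    using separate_compact_closed[OF assms(3) compact_imp_closed[OF assms(4)] assms(5)] by blast
  define \<eta> where "\<eta> = min \<epsilon> (d / 2)"
  have "\<eta> > 0" using d(1) \<open>\<epsilon> > 0\<close> by (simp add: \<eta>_def)
  then obtain \<U> where \<U>: "finite \<U>" "disjoint \<U>" "C \<subseteq> \<Union>\<U>"
      "\<And>U. U \<in> \<U> \<Longrightarrow> open U \<and> C \<inter> U \<noteq> {} \<and> (\<forall>x\<in>U. \<forall>y\<in>U. dist x y < \<eta>) \<and> compressible_in U C"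
    using assms(1) unfolding shrinkable_def by meson
  obtain \<V> where \<V>: "finite \<V>" "disjoint \<V>" "D \<subseteq> \<Union>\<V>"
      "\<And>V. V \<in> \<V> \<Longrightarrow> open V \<and> D \<inter> V \<noteq> {} \<and> (\<forall>x\<in>V. \<forall>y\<in>V. dist x y < \<eta>) \<and> compressible_in V D"
    using assms(2) \<open>\<eta> > 0\<close> unfolding shrinkable_def by meson
  have dj: "U \<inter> V = {}" if UV: "U \<in> \<U>" "V \<in> \<V>" for U V
  proof (rule ccontr)
    assume "U \<inter> V \<noteq> {}"
    then obtain z where z: "z \<in> U" "z \<in> V" by blast
    obtain x y where xy: "x \<in> C" "x \<in> U" "y \<in> D" "y \<in> V" using \<U>(4)[OF UV(1)] \<V>(4)[OF UV(2)] by blast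
    have "dist x z < \<eta>" "dist z y < \<eta>" using xy z \<U>(4)[OF UV(1)] \<V>(4)[OF UV(2)] by auto
    then have "dist x y < d" using dist_triangle[of x y z] by (auto simp: \<eta>_def)
    then show False using d(2) xy by fastforce
  qed
  show "\<exists>\<U>. finite \<U> \<and> disjoint \<U> \<and> C \<union> D \<subseteq> \<Union>\<U> \<and>
        (\<forall>U\<in>\<U>. open U \<and> (C \<union> D) \<inter> U \<noteq> {} \<and> (\<forall>x\<in>U. \<forall>y\<in>U. dist x y < \<epsilon>) \<and> compressible_in U (C \<union> D))"
  proof (intro exI[of _ "\<U> \<union> \<V>"] conjI ballI)
    show "disjoint (\<U> \<union> \<V>)" using \<U>(2) \<V>(2) dj by (intro disjoint_union) blast+
    fix W assume W: "W \<in> \<U> \<union> \<V>"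
    then show "open W" "(C \<union> D) \<inter> W \<noteq> {}" using \<U>(4) \<V>(4) by blast+
    show "dist x y < \<epsilon>" if "x \<in> W" "y \<in> W" for x y
    proof -
      have "dist x y < \<eta>" using W that \<U>(4) \<V>(4) by blast
      then show ?thesis by (simp add: \<eta>_def)
    qed
    show "compressible_in W (C \<union> D)"
    proof (cases "W \<in> \<U>")
      case True
      have "D \<inter> W = {}" using dj[OF True] \<V>(3) by blast
      have "compressible_in W C" using \<U>(4)[OF True] by (elim conjE)
      then show ?thesis by (rule compressible_in_mono) (use \<open>D \<inter> W = {}\<close> in blast)
    next
      case False
      then have "W \<in> \<V>" using W by blast
      then have "C \<inter> W = {}" using dj \<U>(3) by blast
      have "compressible_in W D" using \<V>(4)[OF \<open>W \<in> \<V>\<close>] by (elim conjE)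
      then show ?thesis by (rule compressible_in_mono) (use \<open>C \<inter> W = {}\<close> in blast)
    qed
  qed (use \<U>(1,3) \<V>(1,3) in auto)
qed

section \<open>Zero-dimensional compact subsets of a hyperplane\<close>

text \<open>Round balls about the parts of a fine partition may overlap inside the hyperplane. A
  shear in the normal direction, built from a function that is constant on each part, puts the parts
  at different heights; there disjoint balls contain them, and the preimages of these balls are the
  required neighbourhoods.\<close>

lemma shrinkable_zero_dimensional_in_hyperplane:
  fixes e :: "'a::euclidean_space"
  assumes "norm e = 1" "\<And>x. x \<in> C \<Longrightarrow> e \<bullet> x = b"
    and part: "\<And>\<epsilon>. \<epsilon> > 0 \<Longrightarrow> \<exists>\<V>. finite \<V> \<and> disjoint \<V> \<and> \<Union>\<V> = C \<and>
                 (\<forall>V\<in>\<V>. compact V \<and> (\<forall>x\<in>V. \<forall>y\<in>V. dist x y < \<epsilon>))"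
  shows "shrinkable C"
  unfolding shrinkable_def
proof (intro allI impI)
  fix \<epsilon> :: real assume "\<epsilon> > 0"
  \<comment> \<open>The neighbourhood of a part will lie within \<open>6 * \<eta>\<close> of a point
    of that part (fact \<open>near\<close>), so its diameter is below
    \<open>12 * \<eta>\<close>.\<close>
  define \<eta> where "\<eta> = \<epsilon> / 12"
  have "\<eta> > 0" using \<open>\<epsilon> > 0\<close> by (simp add: \<eta>_def)
  obtain \<V>\<^sub>0 where \<V>\<^sub>0: "finite \<V>\<^sub>0" "disjoint \<V>\<^sub>0" "\<Union>\<V>\<^sub>0 = C"
      "\<forall>V\<in>\<V>\<^sub>0. compact V \<and> (\<forall>x\<in>V. \<forall>y\<in>V. dist x y < \<eta>)"
    using part[OF \<open>\<eta> > 0\<close>] by metis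
  define \<V> where "\<V> = \<V>\<^sub>0 - {{}}"
  have \<V>: "finite \<V>" "disjoint \<V>" "\<Union>\<V> = C"
    using \<V>\<^sub>0(1-3) by (auto simp: \<V>_def intro: pairwise_subset)
  have cptV: "compact V" and neV: "V \<noteq> {}" if "V \<in> \<V>" for V
    using \<V>\<^sub>0(4) that by (auto simp: \<V>_def)
  have diam: "dist x y < \<eta>" if "V \<in> \<V>" "x \<in> V" "y \<in> V" for V x y
    using \<V>\<^sub>0(4) that by (auto simp: \<V>_def)
  have uniq: "V = W" if "V \<in> \<V>" "W \<in> \<V>" "x \<in> V" "x \<in> W" for V W x
    using \<V>(2) that by (metis disjnt_iff pairwiseD)
  obtain idx :: "'a set \<Rightarrow> nat" and N where idx: "inj_on idx \<V>" "idx ` \<V> = {i. i < N}"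
    using finite_imp_inj_to_nat_seg[OF \<V>(1)] by blast
  have idxN: "idx V < N" if "V \<in> \<V>" for V using idx(2) that by blast
  have "\<exists>c. \<forall>V\<in>\<V>. c V \<in> V" using neV by (intro bchoice) blast
  then obtain c where c: "\<And>V. V \<in> \<V> \<Longrightarrow> c V \<in> V" by blast
  define F\<^sub>0 where "F\<^sub>0 x = 6 * \<eta> * real (idx (THE V. V \<in> \<V> \<and> x \<in> V))" for x
  have F\<^sub>0: "F\<^sub>0 x = 6 * \<eta> * real (idx V)" if "V \<in> \<V>" "x \<in> V" for V x
  proof -
    have "(THE V. V \<in> \<V> \<and> x \<in> V) = V" using that uniq by (intro the_equality) auto
    then show ?thesis by (simp add: F\<^sub>0_def)
  qed
  have "continuous_on (\<Union>V\<in>\<V>. V) F\<^sub>0"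
  proof (rule continuous_on_closed_Union[OF \<V>(1)])
    show "closed V" if "V \<in> \<V>" for V using cptV[OF that] by (rule compact_imp_closed)
    show "continuous_on V F\<^sub>0" if "V \<in> \<V>" for V
      by (rule continuous_on_cong[THEN iffD2, OF refl F\<^sub>0[OF that]]) (auto intro: continuous_intros)
  qed
  then have contF\<^sub>0: "continuous_on C F\<^sub>0" using \<V>(3) by simp
  have "compact (\<Union>\<V>)" using cptV \<V>(1) by (intro compact_Union) auto
  then have clC: "closedin (top_of_set UNIV) C" using \<V>(3) by (simp add: compact_imp_closed)
  define B where "B = 6 * \<eta> * real N"
  have "0 \<le> B" using \<open>\<eta> > 0\<close> by (simp add: B_def)
  have rangeF\<^sub>0: "F\<^sub>0 x \<in> cbox 0 B" if "x \<in> C" for x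
  proof -
    obtain V where V: "V \<in> \<V>" "x \<in> V" using \<V>(3) \<open>x \<in> C\<close> by blast
    have "real (idx V) \<le> real N" using idxN[OF V(1)] by simp
    then show ?thesis using F\<^sub>0[OF V] \<open>\<eta> > 0\<close> by (simp add: B_def)
  qed
  \<comment> \<open>The range bound matters at the points of the neighbourhoods outside
    \<open>C\<close>, where nothing else is known about the extension.\<close>
  obtain F where F: "continuous_on UNIV F" "\<And>x. x \<in> C \<Longrightarrow> F x = F\<^sub>0 x" "\<And>x. F x \<in> cbox 0 B"
    using Tietze_closed_interval_1[OF contF\<^sub>0 clC \<open>0 \<le> B\<close> rangeF\<^sub>0] by (metis UNIV_I)
  text \<open>The map \<sigma> lifts the pieces of \<open>C\<close> to heights \<open>6 * \<eta>\<close> apart, so that they lie in disjoint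
    balls; stretching the normal direction by the large factor \<open>s\<close> keeps the preimages of these
    balls small, although the lift itself is not.\<close>
  define s where "s = 2 + 12 * real N"
  have "s > 0" by (simp add: s_def add_pos_nonneg)
  define t where "t y = e \<bullet> y - b" for y
  define q where "q y = y - t y *\<^sub>R e" for y
  define \<sigma> where "\<sigma> y = q y + (s * t y + F (q y)) *\<^sub>R e" for y
  define \<tau> where "\<tau> z = q z + ((t z - F (q z)) / s) *\<^sub>R e" for z
  have ee: "e \<bullet> e = 1" using assms(1) by (simp add: dot_square_norm)
  have tq: "t (q y + r *\<^sub>R e) = r" for y r
    by (simp add: t_def q_def inner_diff_right inner_add_right ee)
  have qq: "q (q y + r *\<^sub>R e) = q y" for y r
    unfolding q_def[of "q y + r *\<^sub>R e"] tq by simp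
  have contq: "continuous_on UNIV q" "continuous_on UNIV t"
    unfolding q_def t_def by (intro continuous_intros)+
  \<comment> \<open>The lift is a function of the horizontal part \<open>q y\<close> alone, which
    \<sigma> preserves; hence \<tau> can subtract it again.\<close>
  have hom: "homeomorphism UNIV UNIV \<sigma> \<tau>"
    unfolding homeomorphism_UNIV_iff
  proof (intro conjI allI)
    show "continuous_on UNIV \<sigma>" "continuous_on UNIV \<tau>" unfolding \<sigma>_def \<tau>_def
      using \<open>s > 0\<close> by (intro continuous_intros contq continuous_on_compose2[OF F(1)]; simp)+
    show "\<tau> (\<sigma> y) = y" for y
      unfolding \<tau>_def \<sigma>_def qq tq using \<open>s > 0\<close> by (simp add: q_def)
    show "\<sigma> (\<tau> y) = y" for y
      unfolding \<tau>_def \<sigma>_def qq tq using \<open>s > 0\<close> by (simp add: q_def)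
  qed
  then have inv: "\<tau> (\<sigma> y) = y" "\<sigma> (\<tau> y) = y" for y by (auto simp: homeomorphism_UNIV_iff)
  \<comment> \<open>The centres differ in height by at least \<open>6 * \<eta>\<close>, more than
    the sum \<open>4 * \<eta>\<close> of two radii.\<close>
  define w where "w V = c V + (6 * \<eta> * real (idx V)) *\<^sub>R e" for V
  define U where "U V = \<tau> ` ball (w V) (2 * \<eta>)" for V
  have cC: "c V \<in> C" if "V \<in> \<V>" for V using c[OF that] that \<V>(3) by blast
  have tC: "t x = 0" "q x = x" if "x \<in> C" for x using assms(2)[OF that] by (simp_all add: t_def q_def)
  have \<sigma>V: "\<sigma> x = x + (6 * \<eta> * real (idx V)) *\<^sub>R e" if "V \<in> \<V>" "x \<in> V" for V x
  proof -
    have "x \<in> C" using that \<V>(3) by blast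
    then show ?thesis using F(2) F\<^sub>0[OF that] tC by (simp add: \<sigma>_def)
  qed
  have \<sigma>_in: "\<sigma> ` V \<subseteq> ball (w V) (2 * \<eta>)" if "V \<in> \<V>" for V
  proof clarify
    fix x assume "x \<in> V"
    then show "\<sigma> x \<in> ball (w V) (2 * \<eta>)"
      using diam[OF that c[OF that] \<open>x \<in> V\<close>] \<sigma>V[OF that] \<open>\<eta> > 0\<close> by (simp add: w_def dist_norm)
  qed
  have VU: "V \<subseteq> U V" if "V \<in> \<V>" for V
  proof
    fix x assume "x \<in> V"
    then have "\<sigma> x \<in> ball (w V) (2 * \<eta>)" using \<sigma>_in[OF that] by blast
    then show "x \<in> U V" unfolding U_def by (rule rev_image_eqI) (simp add: inv)
  qed
  have tw: "t (w V) = 6 * \<eta> * real (idx V)" "q (w V) = c V" if "V \<in> \<V>" for V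
    using tq[of "c V"] qq[of "c V"] tC[OF cC[OF that]] by (auto simp: w_def)
  have tdiff: "\<bar>t x - t y\<bar> \<le> dist x y" for x y
  proof -
    have "t x - t y = e \<bullet> (x - y)" by (simp add: t_def inner_diff_right)
    then show ?thesis using Cauchy_Schwarz_ineq2[of e "x - y"] assms(1) by (simp add: dist_norm)
  qed
  have qdiff: "dist (q x) (q y) \<le> 2 * dist x y" for x y
  proof -
    have "q x - q y = (x - y) - (t x - t y) *\<^sub>R e" by (simp add: q_def algebra_simps)
    then have "norm (q x - q y) \<le> norm (x - y) + norm ((t x - t y) *\<^sub>R e)" by (metis norm_triangle_ineq4)
    also have "norm ((t x - t y) *\<^sub>R e) \<le> dist x y" using tdiff assms(1) by simp
    finally show ?thesis by (simp add: dist_norm)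
  qed
  have djU: "U V \<inter> U W = {}" if "V \<in> \<V>" "W \<in> \<V>" "V \<noteq> W" for V W
  proof (rule ccontr)
    assume "U V \<inter> U W \<noteq> {}"
    then obtain z where "\<sigma> z \<in> ball (w V) (2 * \<eta>)" "\<sigma> z \<in> ball (w W) (2 * \<eta>)"
      by (auto simp: U_def) (metis inv(2) mem_ball)
    then have "dist (w V) (w W) < 4 * \<eta>" using dist_triangle2[of "w V" "w W" "\<sigma> z"] by simp
    then have "\<bar>6 * \<eta> * real (idx V) - 6 * \<eta> * real (idx W)\<bar> < 4 * \<eta>"
      using tdiff[of "w V" "w W"] tw that by simp
    moreover have "\<bar>6 * \<eta> * real (idx V) - 6 * \<eta> * real (idx W)\<bar> = 6 * \<eta> * \<bar>real (idx V) - real (idx W)\<bar>"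
      using \<open>\<eta> > 0\<close> by (simp add: abs_mult flip: right_diff_distrib)
    moreover have "1 \<le> \<bar>real (idx V) - real (idx W)\<bar>"
    proof -
      have "idx V \<noteq> idx W" using idx(1) that by (metis inj_onD)
      then show ?thesis by linarith
    qed
    then have "6 * \<eta> * 1 \<le> 6 * \<eta> * \<bar>real (idx V) - real (idx W)\<bar>"
      using \<open>\<eta> > 0\<close> by (intro mult_left_mono) auto
    ultimately show False using \<open>\<eta> > 0\<close> by linarith
  qed
  \<comment> \<open>The horizontal distance is below \<open>4 * \<eta>\<close>, as \<open>q\<close>
    at most doubles distances. In the normal direction, \<open>s * t y\<close> is bounded by
    \<open>2 * \<eta> + 2 * B\<close>, and \<open>s\<close> was chosen to make this equal to
    \<open>s * \<eta>\<close>.\<close>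
  have near: "dist y (c V) < 6 * \<eta>" if V: "V \<in> \<V>" and y: "y \<in> U V" for V y
  proof -
    have \<sigma>y: "dist (\<sigma> y) (w V) < 2 * \<eta>" using y by (auto simp: U_def inv dist_commute)
    have "q (\<sigma> y) = q y" "t (\<sigma> y) = s * t y + F (q y)" unfolding \<sigma>_def qq tq by simp_all
    then have 1: "dist (q y) (c V) < 4 * \<eta>" and 2: "\<bar>s * t y + F (q y) - 6 * \<eta> * real (idx V)\<bar> < 2 * \<eta>"
      using qdiff[of "\<sigma> y" "w V"] tdiff[of "\<sigma> y" "w V"] \<sigma>y tw[OF V] by auto
    have "0 \<le> F (q y)" "F (q y) \<le> B" using F(3)[of "q y"] by auto
    moreover have "6 * \<eta> * real (idx V) \<le> B" "0 \<le> 6 * \<eta> * real (idx V)"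
      using idxN[OF V] \<open>\<eta> > 0\<close> by (auto simp: B_def)
    ultimately have "\<bar>s * t y\<bar> < 2 * \<eta> + 2 * B" using 2 \<open>0 \<le> B\<close> by linarith
    also have "\<dots> = s * \<eta>" by (simp add: s_def B_def algebra_simps)
    finally have "s * \<bar>t y\<bar> < s * \<eta>" using \<open>s > 0\<close> by (simp add: abs_mult)
    then have "\<bar>t y\<bar> < \<eta>" using \<open>s > 0\<close> by simp
    moreover have "dist y (q y) = \<bar>t y\<bar>" using assms(1) by (simp add: q_def dist_norm)
    ultimately show ?thesis using 1 dist_triangle[of y "c V" "q y"] \<open>\<eta> > 0\<close> by simp
  qed
  show "\<exists>\<U>. finite \<U> \<and> disjoint \<U> \<and> C \<subseteq> \<Union>\<U> \<and>
        (\<forall>U\<in>\<U>. open U \<and> C \<inter> U \<noteq> {} \<and> (\<forall>x\<in>U. \<forall>y\<in>U. dist x y < \<epsilon>) \<and> compressible_in U C)"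
  proof (intro exI[of _ "U ` \<V>"] conjI ballI)
    show "finite (U ` \<V>)" using \<V>(1) by simp
    show "disjoint (U ` \<V>)"
    proof (rule pairwiseI)
      fix A B assume "A \<in> U ` \<V>" "B \<in> U ` \<V>" "A \<noteq> B"
      then show "disjnt A B" using djU unfolding disjnt_def by blast
    qed
    show "C \<subseteq> \<Union> (U ` \<V>)" using VU \<V>(3) by blast
    fix A assume "A \<in> U ` \<V>"
    then obtain V where V: "V \<in> \<V>" "A = U V" by blast
    show "open A" unfolding V(2) U_def
      using homeomorphism_imp_open_map[OF homeomorphism_symD[OF hom]] by (metis open_ball open_openin subtopology_UNIV)
    show "C \<inter> A \<noteq> {}" using VU[OF V(1)] cC[OF V(1)] c[OF V(1)] V(2) by blast
    show "dist x y < \<epsilon>" if "x \<in> A" "y \<in> A" for x y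
    proof -
      have "dist x (c V) < 6 * \<eta>" "dist y (c V) < 6 * \<eta>" using near[OF V(1)] that V(2) by auto
      then show ?thesis using dist_triangle2[of x y "c V"] by (simp add: \<eta>_def)
    qed
    have "compact (\<sigma> ` V)"
      using cptV[OF V(1)] hom by (meson compact_continuous_image continuous_on_subset homeomorphism_UNIV_iff subset_UNIV)
    then have "compressible_in (ball (w V) (2 * \<eta>)) (\<sigma> ` V)" using \<sigma>_in[OF V(1)] by (rule compressible_in_ball)
    then have "compressible_in (U V) (\<tau> ` (\<sigma> ` V))" unfolding U_def
      by (rule compressible_in_homeomorphic_image[OF homeomorphism_symD[OF hom]])
    moreover have "\<tau> ` (\<sigma> ` V) = V" by (simp add: image_image inv)
    moreover have "C \<inter> U V \<subseteq> V"
    proof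
      fix x assume x: "x \<in> C \<inter> U V"
      then obtain W where W: "W \<in> \<V>" "x \<in> W" using \<V>(3) by blast
      then have "W = V" using djU[OF W(1) V(1)] VU[OF W(1)] x by blast
      then show "x \<in> V" using W by simp
    qed
    ultimately show "compressible_in A C" using V(2) compressible_in_mono by metis
  qed
qed

section \<open>The covering dimension of a simplex\<close>

text \<open>Lebesgue's covering theorem, derived from Brouwer's fixed point theorem. The sets
  \<open>U i\<close> where the \<open>i\<close>-th barycentric coordinate is positive cover the
  simplex. A refinement in which each point has at most \<open>m\<close> members can be grouped into
  \<open>m + 1\<close> sets \<open>W i\<close> inside the \<open>U i\<close>, so that each point
  misses some \<open>W i\<close>. A map with weights supported on the \<open>W i\<close> has a fixed
  point that misses all of them as soon as it misses one, contradicting that they cover.\<close>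

lemma simplex_covering_dim_ge:
  fixes S :: "'a::euclidean_space set" and X :: "'b::metric_space set"
  assumes hom: "homeomorphism X S h h'" and "int m simplex S"
  shows "\<not> covering_dim_le (top_of_set X) (int m - 1)"
proof
  assume dim: "covering_dim_le (top_of_set X) (int m - 1)"
  obtain C where C: "\<not> affine_dependent C" "int (card C) = int m + 1" "S = convex hull C"
    using assms(2) unfolding simplex_def by blast
  define N where "N = m + 1"
  have "finite C" using C(1) by (rule aff_independent_finite)
  have "card C = N" using C(2) by (simp add: N_def)
  then obtain c where c: "bij_betw c {0..<N} C" using ex_bij_betw_nat_finite[OF \<open>finite C\<close>] by blast
  have "compact S" "convex S" "S \<noteq> {}"
    using C \<open>finite C\<close> by (auto simp: finite_imp_compact_convex_hull)
  have hX: "h x \<in> S" "h' (h x) = x" if "x \<in> X" for x using hom that by (auto simp: homeomorphism_def)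
  have h'S: "h' y \<in> X" "h (h' y) = y" if "y \<in> S" for y using hom that by (auto simp: homeomorphism_def)
  have conth: "continuous_on X h" "continuous_on S h'" using hom by (auto simp: homeomorphism_def)
  have "compact X" using \<open>compact S\<close> hom by (metis compact_continuous_image homeomorphism_def)
  have "X \<noteq> {}" using \<open>S \<noteq> {}\<close> h'S by blast
  show False
  \<comment> \<open>For \<open>m = 0\<close> the assumed bound is -1, which means emptiness. The
    main argument needs at least two vertices (fact \<open>neXW\<close>).\<close>
  proof (cases "m = 0")
    case True
    then have "topspace (top_of_set X) = {}" using dim by (simp add: covering_dim_le_neg1_iff)
    then show False using \<open>X \<noteq> {}\<close> by simp
  next
    case False
    define face where "face i = convex hull (C - {c i})" for i
    define U where "U i = {x \<in> X. h x \<notin> face i}" for i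
    have opU: "openin (top_of_set X) (U i)" for i
    proof -
      have "closed (face i)" unfolding face_def
        using \<open>finite C\<close> by (intro compact_imp_closed finite_imp_compact_convex_hull) auto
      then have "openin (top_of_set X) (X \<inter> h -` (- face i))"
        using conth(1) by (intro continuous_openin_preimage_gen) auto
      moreover have "X \<inter> h -` (- face i) = U i" by (auto simp: U_def)
      ultimately show ?thesis by simp
    qed
    have coverU: "\<Union>(U ` {0..<N}) = X"
    proof
      show "X \<subseteq> \<Union>(U ` {0..<N})"
      proof (rule ccontr)
        assume "\<not> X \<subseteq> \<Union>(U ` {0..<N})"
        then obtain x where x: "x \<in> X" "x \<notin> \<Union>(U ` {0..<N})" by blast
        then have x2: "h x \<in> face i" if "i < N" for i using that by (auto simp: U_def)
        \<comment> \<open>By affine independence the hulls of sets of vertices intersect in the hull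
          of the intersection. No vertex lies in all the facets, so no point does.\<close>
        define \<S> where "\<S> = (\<lambda>i. C - {c i}) ` {0..<N}"
        have "\<not> affine_dependent (\<Union>\<S>)"
          using C(1) by (rule affine_independent_subset) (auto simp: \<S>_def)
        then have "convex hull (\<Inter>\<S>) = (\<Inter>T\<in>\<S>. convex hull T)" by (rule convex_hull_Inter)
        moreover have "h x \<in> (\<Inter>T\<in>\<S>. convex hull T)" using x2 by (auto simp: \<S>_def face_def)
        moreover have "\<Inter>\<S> = {}"
        proof -
          have "C = c ` {0..<N}" using c by (simp add: bij_betw_def)
          moreover have "0 < N" by (simp add: N_def)
          ultimately show ?thesis by (force simp: \<S>_def)
        qed
        ultimately show False by simp
      qed
    qed (auto simp: U_def)
    have "\<exists>\<V>. finite \<V> \<and> (\<forall>V\<in>\<V>. openin (top_of_set X) V \<and> (\<exists>A\<in>U ` {0..<N}. V \<subseteq> A)) \<and>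
        \<Union>\<V> = topspace (top_of_set X) \<and>
        (\<forall>x\<in>topspace (top_of_set X). int (card {V \<in> \<V>. x \<in> V}) \<le> int m - 1 + 1)"
      by (rule dim[unfolded covering_dim_le_def, rule_format]) (use opU coverU in auto)
    then obtain \<V> where \<V>: "finite \<V>" "\<forall>V\<in>\<V>. openin (top_of_set X) V \<and> (\<exists>A\<in>U ` {0..<N}. V \<subseteq> A)"
        "\<Union>\<V> = X" "\<forall>x\<in>X. int (card {V \<in> \<V>. x \<in> V}) \<le> int m - 1 + 1"
      by (elim exE conjE) (simp only: topspace_euclidean_subtopology)
    have "\<forall>V\<in>\<V>. \<exists>i. i < N \<and> V \<subseteq> U i" using \<V>(2) by fastforce
    then obtain \<tau> where \<tau>: "\<forall>V\<in>\<V>. \<tau> V < N \<and> V \<subseteq> U (\<tau> V)" using bchoice by meson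
    \<comment> \<open>Merging the members with the same index does not raise the number of sets
      through a point, which therefore stays below \<open>N\<close>.\<close>
    define W where "W i = \<Union>{V \<in> \<V>. \<tau> V = i}" for i
    have opW: "openin (top_of_set X) (W i)" for i
      unfolding W_def using \<V>(2) by (intro openin_Union) auto
    have WU: "W i \<subseteq> U i" for i using \<tau> by (auto simp: W_def)
    have coverW: "\<exists>i<N. x \<in> W i" if "x \<in> X" for x
    proof -
      obtain V where "V \<in> \<V>" "x \<in> V" using \<V>(3) \<open>x \<in> X\<close> by blast
      then show ?thesis using \<tau> by (intro exI[of _ "\<tau> V"]) (auto simp: W_def)
    qed
    have missW: "\<exists>i<N. x \<notin> W i" if "x \<in> X" for x
    proof (rule ccontr)
      assume "\<not> (\<exists>i<N. x \<notin> W i)"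
      then have "{0..<N} \<subseteq> \<tau> ` {V \<in> \<V>. x \<in> V}" by (fastforce simp: W_def)
      then have "N \<le> card {V \<in> \<V>. x \<in> V}"
        using surj_card_le[of "{V \<in> \<V>. x \<in> V}" "{0..<N}" \<tau>] \<V>(1) by simp
      then show False using \<V>(4) \<open>x \<in> X\<close> by (force simp: N_def)
    qed
    have clXW: "closed (X - W i)" for i
    proof -
      have "closedin (top_of_set X) (X - W i)" using closedin_diff[OF closedin_topspace opW[of i]] by simp
      then show ?thesis using \<open>compact X\<close> by (meson closedin_compact compact_imp_closed)
    qed
    text \<open>Needed because \<open>infdist x {} = 0\<close>.\<close>
    have neXW: "X - W i \<noteq> {}" if "i < N" for i
    proof -
      obtain j where j: "j < N" "j \<noteq> i" using False that
        by (cases "i = 0") (auto simp: N_def intro: that)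
      have "c i \<noteq> c j" "c j \<in> C" using c j that by (auto simp: bij_betw_def inj_on_def)
      then have "c j \<in> face i" "c j \<in> S" unfolding face_def C(3) by (auto intro: hull_inc)
      then have "h' (c j) \<in> X - U i" using h'S by (simp add: U_def)
      then show ?thesis using WU by blast
    qed
    define d where "d i x = infdist x (X - W i)" for i x
    have d0: "0 \<le> d i x" for i x by (simp add: d_def infdist_nonneg)
    have d_zero: "d i x = 0 \<longleftrightarrow> x \<notin> W i" if "i < N" "x \<in> X" for i x
      using in_closed_iff_infdist_zero[OF clXW neXW[OF that(1)], of x] that(2) by (simp add: d_def)
    define D where "D x = (\<Sum>i<N. d i x)" for x
    have Dpos: "0 < D x" if x: "x \<in> X" for x
    proof -
      obtain i where "i < N" "x \<in> W i" using coverW[OF x] by blast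
      then have "0 < d i x" using d_zero[OF _ x] d0[of i x] by force
      also have "d i x \<le> D x" unfolding D_def using \<open>i < N\<close> d0 by (intro member_le_sum) auto
      finally show ?thesis .
    qed
    define pu where "pu i x = d i x / D x" for i x
    have pu_nonneg: "0 \<le> pu i x" if "x \<in> X" for i x using d0 Dpos[OF that] by (simp add: pu_def)
    have pu_sum: "(\<Sum>i<N. pu i x) = 1" if "x \<in> X" for x
      using Dpos[OF that] by (simp add: pu_def D_def flip: sum_divide_distrib)
    have cont_pu: "continuous_on X (pu i)" for i
      unfolding pu_def D_def d_def
      by (intro continuous_intros ballI) (use Dpos in \<open>force simp: D_def d_def\<close>)
    text \<open>Sending the weight of \<open>W i\<close> to the next vertex in cyclic order makes the set of vanishing
      weights of a Brouwer fixed point invariant under the cyclic shift.\<close>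
    define nx where "nx i = (i + 1) mod N" for i
    have nxN: "nx i < N" for i by (simp add: nx_def N_def)
    have cC: "c i \<in> C" if "i < N" for i using c that by (auto simp: bij_betw_def)
    have nx_inj: "i = j" if "nx i = nx j" "i < N" "j < N" for i j
      using that unfolding nx_def
      by (metis Suc_eq_plus1 Suc_lessI mod_less mod_self nat.inject nat.simps(3))
    define f where "f y = (\<Sum>i<N. pu i (h' y) *\<^sub>R c (nx i))" for y
    have fS: "f y \<in> S" if "y \<in> S" for y
      unfolding f_def using \<open>convex S\<close> pu_sum[OF h'S(1)[OF that]] pu_nonneg[OF h'S(1)[OF that]] cC[OF nxN]
      by (intro convex_sum) (auto simp: C(3) intro: hull_inc)
    have "continuous_on S f"
      unfolding f_def
      by (intro continuous_intros continuous_on_compose2[OF cont_pu conth(2)]) (use h'S in auto)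
    then obtain y where y: "y \<in> S" "f y = y"
      using brouwer[OF \<open>compact S\<close> \<open>convex S\<close> \<open>S \<noteq> {}\<close>, of f] fS by blast
    define x where "x = h' y"
    have x: "x \<in> X" "h x = y" using h'S[OF y(1)] by (auto simp: x_def)
    \<comment> \<open>The vertex \<open>c (nx i)\<close> receives only the weight of
      \<open>W i\<close>, because \<open>nx\<close> is injective. If this weight vanishes, then
      \<open>y\<close> lies in the facet opposite that vertex, which \<open>U (nx i)\<close>
      avoids.\<close>
    have step: "x \<notin> W (nx i)" if i: "i < N" "x \<notin> W i" for i
    proof -
      have "pu i x = 0" using d_zero[OF i(1) x(1)] i(2) by (simp add: pu_def)
      then have s1: "(\<Sum>j\<in>{..<N} - {i}. pu j x) = 1"
        using pu_sum[OF x(1)] sum.remove[of "{..<N}" i "\<lambda>j. pu j x"] i(1) by simp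
      have "y = (\<Sum>j\<in>{..<N} - {i}. pu j x *\<^sub>R c (nx j))"
        using y(2) sum.remove[of "{..<N}" i "\<lambda>j. pu j x *\<^sub>R c (nx j)"] i(1) \<open>pu i x = 0\<close>
        by (simp add: f_def x_def)
      also have "\<dots> \<in> face (nx i)"
        unfolding face_def
      proof (intro convex_sum s1 pu_nonneg x(1) hull_inc)
        fix j assume j: "j \<in> {..<N} - {i}"
        then have "nx j \<noteq> nx i" using nx_inj i(1) by blast
        then have "c (nx j) \<noteq> c (nx i)" using inj_onD[OF bij_betw_imp_inj_on[OF c], of "nx j" "nx i"] nxN by auto
        then show "c (nx j) \<in> C - {c (nx i)}" using cC[OF nxN] by blast
      qed auto
      finally show ?thesis using x WU[of "nx i"] by (auto simp: U_def)
    qed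
    obtain i where i: "i < N" "x \<notin> W i" using missW[OF x(1)] by blast
    have "x \<notin> W ((i + k) mod N)" for k
    proof (induction k)
      case (Suc k)
      have "nx ((i + k) mod N) = (i + Suc k) mod N" by (simp add: nx_def mod_Suc_eq)
      then show ?case using step[OF _ Suc] by (simp add: N_def)
    qed (use i in simp)
    moreover obtain j where j: "j < N" "x \<in> W j" using coverW[OF x(1)] by blast
    \<comment> \<open>Going around the cycle leads from the missed index \<open>i\<close> to the
      index \<open>j\<close> of a set that contains \<open>x\<close>.\<close>
    moreover have "(i + (N - i + j)) mod N = j" using i(1) j(1) by simp
    ultimately show False by metis
  qed
qed

section \<open>Generic homeomorphisms have injective height\<close>

text \<open>A bijection that fixes the complement of a set pointwise maps the set into itself. Maps
  supported in disjoint sets therefore do not interfere, and their composition acts as each of them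
  on its own set.\<close>

lemma paste_homeomorphisms:
  assumes "finite \<U>" "disjoint \<U>"
    and "\<And>U. U \<in> \<U> \<Longrightarrow> \<exists>g'. homeomorphism UNIV UNIV (g U) g'"
    and "\<And>U x. U \<in> \<U> \<Longrightarrow> x \<notin> U \<Longrightarrow> g U x = x"
  obtains f f' where "homeomorphism UNIV UNIV f f'" "\<And>U x. U \<in> \<U> \<Longrightarrow> x \<in> U \<Longrightarrow> f x = g U x"
    "\<And>x. x \<notin> \<Union>\<U> \<Longrightarrow> f x = x"
proof -
  have "\<exists>f f'. homeomorphism UNIV UNIV f f' \<and> (\<forall>U\<in>\<U>. \<forall>x\<in>U. f x = g U x) \<and> (\<forall>x. x \<notin> \<Union>\<U> \<longrightarrow> f x = x)"
    using assms
  proof (induction \<U> rule: finite_induct)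
    case empty
    show ?case by (intro exI[of _ id]) (simp add: homeomorphism_UNIV_iff)
  next
    case (insert W \<U>)
    have "\<exists>f f'. homeomorphism UNIV UNIV f f' \<and> (\<forall>U\<in>\<U>. \<forall>x\<in>U. f x = g U x) \<and> (\<forall>x. x \<notin> \<Union>\<U> \<longrightarrow> f x = x)"
      using insert.prems by (intro insert.IH) (auto simp: pairwise_insert)
    then obtain f f' where f: "homeomorphism UNIV UNIV f f'" "\<And>U x. U \<in> \<U> \<Longrightarrow> x \<in> U \<Longrightarrow> f x = g U x"
      "\<And>x. x \<notin> \<Union>\<U> \<Longrightarrow> f x = x" by blast
    obtain g' where g': "homeomorphism UNIV UNIV (g W) g'" using insert.prems(2)[of W] by auto
    have W: "W \<inter> U = {}" if "U \<in> \<U>" for U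
      using that insert.prems(1) insert.hyps(2) by (auto simp: pairwise_insert disjnt_def)
    have gW: "g W x = x" if "x \<notin> W" for x using insert.prems(3)[of W x] that by simp
    have fW: "(f \<circ> g W) x = g W x" if "x \<in> W" for x
    proof -
      have "g W x \<in> W"
      proof (rule ccontr)
        assume *: "g W x \<notin> W"
        then have "g W (g W x) = g W x" by (rule gW)
        then have "g W x = x" using g' by (metis homeomorphism_UNIV_iff)
        then show False using * that by simp
      qed
      then have "g W x \<notin> \<Union>\<U>" using W by blast
      then show ?thesis using f(3) by simp
    qed
    show ?case
    proof (intro exI conjI ballI allI impI)
      show "homeomorphism UNIV UNIV (f \<circ> g W) (g' \<circ> f')" using g' f(1) by (rule homeomorphism_compose)
      show "(f \<circ> g W) x = g U x" if U: "U \<in> insert W \<U>" "x \<in> U" for U x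
      proof (cases "U = W")
        case True
        then show ?thesis using fW U by simp
      next
        case False
        then have "U \<in> \<U>" "x \<notin> W" using U W by blast+
        then show ?thesis using gW f(2) U(2) by simp
      qed
      show "(f \<circ> g W) x = x" if "x \<notin> \<Union> (insert W \<U>)" for x using that gW f(3) by simp
    qed
  qed
  then show ?thesis using that by blast
qed

text \<open>A short segment in direction \<open>e\<close> inside an open set has infinitely many
  heights, of which only finitely many are taken.\<close>

lemma choose_points_distinct_heights:
  fixes e :: "'a::euclidean_space"
  assumes "e \<noteq> 0" "finite \<U>" "\<And>U. U \<in> \<U> \<Longrightarrow> open U \<and> U \<noteq> {}"
  obtains p where "\<And>U. U \<in> \<U> \<Longrightarrow> p U \<in> U" "inj_on (\<lambda>U. e \<bullet> p U) \<U>"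
proof -
  have "\<exists>p. (\<forall>U\<in>\<U>. p U \<in> U) \<and> inj_on (\<lambda>U. e \<bullet> p U) \<U>"
    using assms(2,3)
  proof (induction \<U> rule: finite_induct)
    case (insert W \<U>)
    then obtain p where p: "\<forall>U\<in>\<U>. p U \<in> U" "inj_on (\<lambda>U. e \<bullet> p U) \<U>" by auto
    obtain w where "w \<in> W" using insert.prems[of W] by auto
    obtain r where r: "r > 0" "ball w r \<subseteq> W"
      using insert.prems[of W] \<open>w \<in> W\<close> by (meson insertI1 open_contains_ball)
    have "inj_on (\<lambda>t. e \<bullet> (w + t *\<^sub>R e)) {0<..<r / norm e}"
      using assms(1) by (auto simp: inj_on_def inner_add_right)
    then have "infinite ((\<lambda>t. e \<bullet> (w + t *\<^sub>R e)) ` {0<..<r / norm e})"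
      using r(1) assms(1) by (subst finite_image_iff) auto
    then obtain s where "s \<in> (\<lambda>t. e \<bullet> (w + t *\<^sub>R e)) ` {0<..<r / norm e}"
        "s \<notin> (\<lambda>U. e \<bullet> p U) ` \<U>"
      by (meson finite_imageI finite_subset insert.hyps(1) subsetI)
    then obtain t where t: "0 < t" "t < r / norm e" "e \<bullet> (w + t *\<^sub>R e) \<notin> (\<lambda>U. e \<bullet> p U) ` \<U>"
      by auto
    have "w + t *\<^sub>R e \<in> ball w r" using t(1,2) assms(1) by (simp add: dist_norm field_simps)
    then have "w + t *\<^sub>R e \<in> W" using r(2) by blast
    then show ?case
      using p t(3) insert.hyps(2)
      by (intro exI[of _ "p(W := w + t *\<^sub>R e)"]) (auto simp: inj_on_def image_iff)
  qed simp
  then show ?thesis using that by blast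
qed

text \<open>Each small neighbourhood meets only one of \<open>C\<close> and \<open>D\<close>, and
  its part of the set is compressed near one point; the heights of these points are distinct. That
  \<open>g\<close> moves points only near \<open>C \<union> D\<close>, and only a little, is
  recorded so that the inverse can be controlled as well after composition with another
  homeomorphism.\<close>

lemma separate_heights:
  fixes e :: "'a::euclidean_space"
  assumes "norm e = 1" "compact C" "compact D" "C \<inter> D = {}" "shrinkable C" "shrinkable D" "\<epsilon> > 0"
  obtains g g' where "homeomorphism UNIV UNIV g g'" "\<And>x. g x \<noteq> x \<Longrightarrow> \<exists>z\<in>C \<union> D. dist z x < \<epsilon>"
    "\<And>x. dist (g x) x < \<epsilon>" "(\<lambda>x. e \<bullet> g x) ` C \<inter> (\<lambda>x. e \<bullet> g x) ` D = {}"
proof -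
  obtain d where d: "d > 0" "\<And>x y. x \<in> C \<Longrightarrow> y \<in> D \<Longrightarrow> d \<le> dist x y"
    using separate_compact_closed[OF assms(2) compact_imp_closed[OF assms(3)] assms(4)] by blast
  \<comment> \<open>The bound \<epsilon> keeps the movement small; the bound \<open>d\<close>
    prevents a neighbourhood from meeting both sets.\<close>
  define \<eta> where "\<eta> = min \<epsilon> d"
  have "\<eta> > 0" using d(1) assms(7) by (simp add: \<eta>_def)
  obtain \<U> where \<U>: "finite \<U>" "disjoint \<U>" "C \<union> D \<subseteq> \<Union>\<U>"
      "\<And>U. U \<in> \<U> \<Longrightarrow> open U \<and> (C \<union> D) \<inter> U \<noteq> {} \<and> (\<forall>x\<in>U. \<forall>y\<in>U. dist x y < \<eta>) \<and> compressible_in U (C \<union> D)"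
    using shrinkable_Un[OF assms(5,6,2,3,4)] \<open>\<eta> > 0\<close> unfolding shrinkable_def by meson
  have opU: "open U" and neU: "U \<noteq> {}" and cpU: "compressible_in U (C \<union> D)" if "U \<in> \<U>" for U
    using \<U>(4)[OF that] by auto
  have diam: "dist x y < \<eta>" if "U \<in> \<U>" "x \<in> U" "y \<in> U" for x y U
    using \<U>(4)[OF that(1)] that(2,3) by blast
  obtain p where p: "\<And>U. U \<in> \<U> \<Longrightarrow> p U \<in> U" "inj_on (\<lambda>U. e \<bullet> p U) \<U>"
    using choose_points_distinct_heights[of e \<U>] assms(1) \<U>(1) opU neU by (metis norm_zero zero_neq_one)
  obtain \<rho> where \<rho>: "\<rho> > 0" "\<And>U W. U \<in> \<U> \<Longrightarrow> W \<in> \<U> \<Longrightarrow> U \<noteq> W \<Longrightarrow> 2 * \<rho> \<le> \<bar>e \<bullet> p U - e \<bullet> p W\<bar>"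
  proof -
    \<comment> \<open>\<rho> is half of the least gap between two heights. The number 1 is inserted
      because there may be no pair of distinct members.\<close>
    let ?S = "(\<lambda>(U, W). \<bar>e \<bullet> p U - e \<bullet> p W\<bar>) ` {(U, W) \<in> \<U> \<times> \<U>. U \<noteq> W}"
    have fin: "finite (insert 1 ?S)"
      by (intro finite.insertI finite_imageI finite_subset[OF _ finite_cartesian_product[OF \<U>(1) \<U>(1)]]) auto
    have "\<forall>s\<in>insert 1 ?S. s > 0" using p(2) by (auto simp: inj_on_def)
    then have "Min (insert 1 ?S) > 0" using fin by (subst Min_gr_iff) auto
    moreover have "Min (insert 1 ?S) \<le> \<bar>e \<bullet> p U - e \<bullet> p W\<bar>" if "U \<in> \<U>" "W \<in> \<U>" "U \<noteq> W" for U W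
      using fin that by (intro Min_le) force+
    ultimately show ?thesis using that[of "Min (insert 1 ?S) / 2"] by auto
  qed
  have "\<exists>g g'. homeomorphism UNIV UNIV g g' \<and> (\<forall>x. x \<notin> U \<longrightarrow> g x = x) \<and>
      g ` ((C \<union> D) \<inter> U) \<subseteq> U \<inter> ball (p U) \<rho>" if U: "U \<in> \<U>" for U
  proof -
    have "p U \<in> U \<inter> ball (p U) \<rho>" using p(1)[OF U] \<rho>(1) by simp
    then have "open (U \<inter> ball (p U) \<rho>) \<and> U \<inter> ball (p U) \<rho> \<noteq> {} \<and> U \<inter> ball (p U) \<rho> \<subseteq> U"
      using opU[OF U] by blast
    then show ?thesis by (rule cpU[OF U, unfolded compressible_in_def, rule_format])
  qed
  then have "\<exists>G. \<forall>U\<in>\<U>. (\<exists>g'. homeomorphism UNIV UNIV (G U) g') \<and> (\<forall>x. x \<notin> U \<longrightarrow> G U x = x) \<and>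
      G U ` ((C \<union> D) \<inter> U) \<subseteq> U \<inter> ball (p U) \<rho>"
    by (intro bchoice) blast
  then obtain G where G': "\<forall>U\<in>\<U>. (\<exists>g'. homeomorphism UNIV UNIV (G U) g') \<and>
      (\<forall>x. x \<notin> U \<longrightarrow> G U x = x) \<and> G U ` ((C \<union> D) \<inter> U) \<subseteq> U \<inter> ball (p U) \<rho>" ..
  have Ghom: "\<exists>g'. homeomorphism UNIV UNIV (G U) g'" if "U \<in> \<U>" for U
    using bspec[OF G' that] by simp
  have Gid: "G U x = x" if "U \<in> \<U>" "x \<notin> U" for U x
    using bspec[OF G' that(1)] that(2) by simp
  have Gsub: "G U ` ((C \<union> D) \<inter> U) \<subseteq> U \<inter> ball (p U) \<rho>" if "U \<in> \<U>" for U
    using bspec[OF G' that] by simp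
  note G = Ghom Gid Gsub
  obtain g g' where g: "homeomorphism UNIV UNIV g g'" "\<And>U x. U \<in> \<U> \<Longrightarrow> x \<in> U \<Longrightarrow> g x = G U x"
    "\<And>x. x \<notin> \<Union>\<U> \<Longrightarrow> g x = x"
    by (rule paste_homeomorphisms[OF \<U>(1,2), of G]) (use G(1,2) in blast)+
  have GU: "G U x \<in> U" if "U \<in> \<U>" "x \<in> U" for U x
  proof (rule ccontr)
    assume *: "G U x \<notin> U"
    then have "G U (G U x) = G U x" by (rule G(2)[OF that(1)])
    then have "G U x = x" using G(1)[OF that(1)] by (metis homeomorphism_UNIV_iff)
    then show False using * that by simp
  qed
  have near: "\<bar>e \<bullet> g x - e \<bullet> p U\<bar> < \<rho>" if "U \<in> \<U>" "x \<in> U" "x \<in> C \<union> D" for U x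
  proof -
    have "g x \<in> ball (p U) \<rho>" using g(2)[OF that(1,2)] G(3)[OF that(1)] that(2,3) by auto
    then have "norm (g x - p U) < \<rho>" by (simp add: dist_norm norm_minus_commute)
    moreover have "\<bar>e \<bullet> (g x - p U)\<bar> \<le> norm (g x - p U)"
      using Cauchy_Schwarz_ineq2[of e "g x - p U"] assms(1) by simp
    ultimately show ?thesis by (simp add: inner_diff_right)
  qed
  show ?thesis
  proof (rule that[OF g(1)])
    show "\<exists>z\<in>C \<union> D. dist z x < \<epsilon>" if "g x \<noteq> x" for x
    proof -
      obtain U where U: "U \<in> \<U>" "x \<in> U" using g(3) \<open>g x \<noteq> x\<close> by blast
      obtain z where z: "z \<in> C \<union> D" "z \<in> U" using \<U>(4)[OF U(1)] by blast
      then have "dist z x < \<eta>" using diam U by blast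
      then show ?thesis using z(1) by (intro bexI[of _ z]) (simp_all add: \<eta>_def)
    qed
    show "dist (g x) x < \<epsilon>" for x
    proof (cases "x \<in> \<Union>\<U>")
      case True
      then obtain U where U: "U \<in> \<U>" "x \<in> U" by blast
      then have "dist (g x) x < \<eta>" using g(2)[OF U] GU[OF U] diam[OF U(1)] by simp
      then show ?thesis by (simp add: \<eta>_def)
    next
      case False
      then show ?thesis using g(3) assms(7) by simp
    qed
    show "(\<lambda>x. e \<bullet> g x) ` C \<inter> (\<lambda>x. e \<bullet> g x) ` D = {}"
    proof (rule ccontr)
      assume "(\<lambda>x. e \<bullet> g x) ` C \<inter> (\<lambda>x. e \<bullet> g x) ` D \<noteq> {}"
      then obtain x y where xy: "x \<in> C" "y \<in> D" "e \<bullet> g x = e \<bullet> g y" by auto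
      obtain U W where UW: "U \<in> \<U>" "x \<in> U" "W \<in> \<U>" "y \<in> W" using \<U>(3) xy by blast
      have "\<not> dist x y < d" using d(2)[OF xy(1,2)] by simp
      then have "U \<noteq> W" using diam[OF UW(1,2), of y] UW(4) by (auto simp: \<eta>_def)
      then show False
        using \<rho>(2)[OF UW(1,3)] near[OF UW(1,2)] near[OF UW(3,4)] xy by auto
    qed
  qed
qed

text \<open>A homeomorphism at bounded distance from the identity is encoded by the displacements of
  itself and of its inverse; in this encoding the space of such homeomorphisms is closed in a
  complete metric space, so that Baire's theorem applies.\<close>

definition bounded_homeos :: "(('a::euclidean_space \<Rightarrow>\<^sub>C 'a) \<times> ('a \<Rightarrow>\<^sub>C 'a)) set" where
  "bounded_homeos = {(f :: 'a \<Rightarrow>\<^sub>C 'a, g :: 'a \<Rightarrow>\<^sub>C 'a). \<forall>x. (x + f x) + g (x + f x) = x \<and> (x + g x) + f (x + g x) = x}"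

text \<open>Evaluation is jointly continuous. This is needed because the inverse identities evaluate
  one displacement at a point that the other displacement moves along the sequence.\<close>

lemma tendsto_apply_bcontfun:
  fixes f :: "nat \<Rightarrow> 'a::metric_space \<Rightarrow>\<^sub>C 'b::metric_space"
  assumes "f \<longlonglongrightarrow> l" "u \<longlonglongrightarrow> v"
  shows "(\<lambda>n. f n (u n)) \<longlonglongrightarrow> l v"
proof (rule metric_tendsto_imp_tendsto[where f = "\<lambda>n. dist (f n) l + dist (l (u n)) (l v)" and a = 0])
  have "isCont (apply_bcontfun l) v"
    using continuous_on_eq_continuous_at[OF open_UNIV, of "apply_bcontfun l"] by simp
  then have "(\<lambda>n. l (u n)) \<longlonglongrightarrow> l v" using assms(2) by (rule isCont_tendsto_compose)
  then have "(\<lambda>n. dist (f n) l + dist (l (u n)) (l v)) \<longlonglongrightarrow> dist l l + dist (l v) (l v)"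
    using assms(1) by (intro tendsto_intros)
  then show "(\<lambda>n. dist (f n) l + dist (l (u n)) (l v)) \<longlonglongrightarrow> 0" by simp
  show "\<forall>\<^sub>F n in sequentially. dist (f n (u n)) (l v) \<le> dist (dist (f n) l + dist (l (u n)) (l v)) 0"
  proof (intro always_eventually allI)
    fix n
    have "dist (f n (u n)) (l v) \<le> dist (f n (u n)) (l (u n)) + dist (l (u n)) (l v)"
      by (rule dist_triangle)
    also have "\<dots> \<le> dist (f n) l + dist (l (u n)) (l v)" by (simp add: dist_bounded)
    finally show "dist (f n (u n)) (l v) \<le> dist (dist (f n) l + dist (l (u n)) (l v)) 0" by simp
  qed
qed

text \<open>Both inverse identities pass to uniform limits. This is the purpose of recording the
  inverse: a uniform limit of homeomorphisms alone need not be injective.\<close>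

lemma closed_bounded_homeos: "closed bounded_homeos"
  unfolding closed_sequential_limits
proof (intro allI impI, elim conjE)
  fix s :: "nat \<Rightarrow> ('a \<Rightarrow>\<^sub>C 'a) \<times> ('a \<Rightarrow>\<^sub>C 'a)" and l
  assume s: "\<forall>n. s n \<in> bounded_homeos" and lim: "s \<longlonglongrightarrow> l"
  have sn: "(x + fst (s n) x) + snd (s n) (x + fst (s n) x) = x"
      "(x + snd (s n) x) + fst (s n) (x + snd (s n) x) = x" for n x
    using s[rule_format, of n] unfolding bounded_homeos_def
    by (cases "s n", simp only: mem_Collect_eq case_prod_conv fst_conv snd_conv)+
  have f: "(\<lambda>n. fst (s n)) \<longlonglongrightarrow> fst l" and g: "(\<lambda>n. snd (s n)) \<longlonglongrightarrow> snd l"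
    using lim by (auto intro: tendsto_fst tendsto_snd)
  have 1: "(x + fst l x) + snd l (x + fst l x) = x" for x
  proof (rule LIMSEQ_unique)
    show "(\<lambda>n. (x + fst (s n) x) + snd (s n) (x + fst (s n) x)) \<longlonglongrightarrow> (x + fst l x) + snd l (x + fst l x)"
      by (intro tendsto_add tendsto_const tendsto_apply_bcontfun f g)
    show "(\<lambda>n. (x + fst (s n) x) + snd (s n) (x + fst (s n) x)) \<longlonglongrightarrow> x"
      unfolding sn by (rule tendsto_const)
  qed
  have 2: "(x + snd l x) + fst l (x + snd l x) = x" for x
  proof (rule LIMSEQ_unique)
    show "(\<lambda>n. (x + snd (s n) x) + fst (s n) (x + snd (s n) x)) \<longlonglongrightarrow> (x + snd l x) + fst l (x + snd l x)"
      by (intro tendsto_add tendsto_const tendsto_apply_bcontfun f g)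
    show "(\<lambda>n. (x + snd (s n) x) + fst (s n) (x + snd (s n) x)) \<longlonglongrightarrow> x"
      unfolding sn by (rule tendsto_const)
  qed
  show "l \<in> bounded_homeos" unfolding bounded_homeos_def case_prod_beta by (intro CollectI allI conjI 1 2)
qed

lemma homeomorphism_bounded_homeos:
  fixes f g :: "'a::euclidean_space \<Rightarrow>\<^sub>C 'a"
  assumes "(f, g) \<in> bounded_homeos"
  shows "homeomorphism UNIV UNIV (\<lambda>x. x + f x) (\<lambda>x. x + g x)"
  using assms by (auto simp: bounded_homeos_def homeomorphism_UNIV_iff intro!: continuous_intros)

definition separating :: "'a::euclidean_space \<Rightarrow> 'a set \<Rightarrow> 'a set \<Rightarrow> (('a \<Rightarrow>\<^sub>C 'a) \<times> ('a \<Rightarrow>\<^sub>C 'a)) set" where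
  "separating e C D = {(f :: 'a \<Rightarrow>\<^sub>C 'a, g :: 'a \<Rightarrow>\<^sub>C 'a). (\<lambda>x. e \<bullet> (x + f x)) ` C \<inter> (\<lambda>x. e \<bullet> (x + f x)) ` D = {}}"

text \<open>The two compact sets of heights have a gap \<open>d\<close>, and a change of the
  displacement by less than \<open>d / 2\<close> moves each height by less than half of it.\<close>

lemma open_separating:
  fixes e :: "'a::euclidean_space"
  assumes "norm e = 1" "compact C" "compact D"
  shows "open (separating e C D)"
  unfolding open_dist
proof clarify
  fix f g :: "'a \<Rightarrow>\<^sub>C 'a" assume fg: "(f, g) \<in> separating e C D"
  let ?F = "\<lambda>f x. e \<bullet> (x + apply_bcontfun f x)"
  have cpt: "compact (?F f ` C)" "compact (?F f ` D)"
    by (intro compact_continuous_image continuous_intros continuous_on_apply_bcontfun assms)+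
  have dj: "?F f ` C \<inter> ?F f ` D = {}" using fg by (simp add: separating_def)
  then obtain d where d: "d > 0" "\<And>s t. s \<in> ?F f ` C \<Longrightarrow> t \<in> ?F f ` D \<Longrightarrow> d \<le> dist s t"
    using separate_compact_closed[OF cpt(1) compact_imp_closed[OF cpt(2)] dj] by metis
  show "\<exists>\<delta>>0. \<forall>y. dist y (f, g) < \<delta> \<longrightarrow> y \<in> separating e C D"
  proof (intro exI[of _ "d / 2"] conjI allI impI)
    fix y assume y: "dist y (f, g) < d / 2"
    obtain f' g' :: "'a \<Rightarrow>\<^sub>C 'a" where [simp]: "y = (f', g')" by (cases y)
    have close: "\<bar>?F f' x - ?F f x\<bar> < d / 2" for x
    proof -
      have "\<bar>e \<bullet> (f' x - f x)\<bar> \<le> norm (f' x - f x)"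
        using Cauchy_Schwarz_ineq2[of e "f' x - f x"] assms(1) by simp
      also have "\<dots> \<le> dist f' f" unfolding dist_norm[symmetric] by (rule dist_bounded)
      also have "\<dots> \<le> dist y (f, g)" using dist_fst_le[of y "(f, g)"] by simp
      finally show ?thesis using y by (simp add: inner_diff_right inner_add_right)
    qed
    have False if "x \<in> C" "z \<in> D" "?F f' x = ?F f' z" for x z
    proof -
      have "d \<le> \<bar>?F f x - ?F f z\<bar>"
        using d(2)[of "?F f x" "?F f z"] that by (simp add: dist_real_def)
      then show False using close[of x] close[of z] that(3) by linarith
    qed
    then show "y \<in> separating e C D" by (auto simp: separating_def)
  qed (use d(1) in simp)
qed

text \<open>Given \<open>h\<close>, the heights of \<open>h\<close> C\<open>and\<close>h
  \<open>D\<close> are separated by a small homeomorphism \<open>k\<close>, and \<open>h\<close> is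
  replaced by \<open>k\<close> after \<open>h\<close>. The delicate point is that the inverse,
  \<open>h'\<close> after \<open>k'\<close>, must also be uniformly close to
  \<open>h'\<close>.\<close>

lemma dense_separating:
  fixes C D :: "'a::euclidean_space set"
  assumes "norm e = 1" "compact C" "compact D" "C \<inter> D = {}" "shrinkable C" "shrinkable D"
  shows "bounded_homeos \<subseteq> closure (bounded_homeos \<inter> separating e C D)"
proof
  fix p assume "p \<in> (bounded_homeos :: (('a \<Rightarrow>\<^sub>C 'a) \<times> ('a \<Rightarrow>\<^sub>C 'a)) set)"
  moreover obtain f g :: "'a \<Rightarrow>\<^sub>C 'a" where [simp]: "p = (f, g)" by (cases p)
  ultimately have p: "(f, g) \<in> bounded_homeos" by simp
  let ?h = "\<lambda>x. x + f x" and ?h' = "\<lambda>x. x + g x"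
  have h: "homeomorphism UNIV UNIV ?h ?h'" by (rule homeomorphism_bounded_homeos[OF p])
  then have h1: "?h' (?h x) = x" "?h (?h' x) = x" for x by (auto simp: homeomorphism_UNIV_iff)
  show "p \<in> closure (bounded_homeos \<inter> separating e C D)"
    unfolding closure_approachable
  proof (intro allI impI)
    fix \<epsilon> :: real assume "\<epsilon> > 0"
    have ch: "compact (?h ` C)" "compact (?h ` D)"
      by (intro compact_continuous_image continuous_intros continuous_on_apply_bcontfun assms)+
    have dj: "?h ` C \<inter> ?h ` D = {}" proof -
      have "inj ?h" by (rule inj_on_inverseI[of _ ?h']) (rule h1(1))
      then show ?thesis using image_Int[of ?h C D] assms(4) by simp
    qed
    have sh: "shrinkable (?h ` C)" "shrinkable (?h ` D)"
      by (rule shrinkable_homeomorphic_image[OF assms(5,2) h], rule shrinkable_homeomorphic_image[OF assms(6,3) h])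
    obtain R where R: "?h ` C \<union> ?h ` D \<subseteq> cball 0 R"
    proof -
      obtain R where "\<forall>x \<in> ?h ` C \<union> ?h ` D. norm x \<le> R"
        using compact_imp_bounded[OF compact_Un[OF ch]] unfolding bounded_iff by metis
      then have "?h ` C \<union> ?h ` D \<subseteq> cball 0 R" unfolding subset_iff mem_cball_0 by blast
      then show ?thesis by (rule that)
    qed
    \<comment> \<open>Uniform continuity of the inverse is needed only where \<open>k\<close> moves
      points: if \<open>k' y\<close> differs from \<open>y\<close>, then \<open>k' y\<close> lies
      within 1 of the ball of radius \<open>R\<close>, and \<open>y\<close> within 1 of
      \<open>k' y\<close>.\<close>
    have "uniformly_continuous_on (cball 0 (R + 2)) ?h'"
      by (intro compact_uniformly_continuous continuous_intros continuous_on_apply_bcontfun) auto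
    then obtain \<delta>\<^sub>0 where \<delta>\<^sub>0: "\<delta>\<^sub>0 > 0"
      "\<And>x y. x \<in> cball 0 (R + 2) \<Longrightarrow> y \<in> cball 0 (R + 2) \<Longrightarrow> dist x y < \<delta>\<^sub>0 \<Longrightarrow>
         dist (?h' x) (?h' y) < \<epsilon> / 4"
      using \<open>\<epsilon> > 0\<close> unfolding uniformly_continuous_on_def by (metis dist_commute zero_less_divide_iff zero_less_numeral)
    define \<delta> where "\<delta> = min 1 (min \<delta>\<^sub>0 (\<epsilon> / 4))"
    have "\<delta> > 0" using \<delta>\<^sub>0(1) \<open>\<epsilon> > 0\<close> by (simp add: \<delta>_def)
    obtain k k' where k: "homeomorphism UNIV UNIV k k'"
        "\<And>x. k x \<noteq> x \<Longrightarrow> \<exists>z\<in>?h ` C \<union> ?h ` D. dist z x < \<delta>"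
        "\<And>x. dist (k x) x < \<delta>" "(\<lambda>x. e \<bullet> k x) ` (?h ` C) \<inter> (\<lambda>x. e \<bullet> k x) ` (?h ` D) = {}"
    proof (rule separate_heights[OF assms(1) ch dj sh \<open>\<delta> > 0\<close>], goal_cases)
      case (1 g g')
      show thesis by (rule 1(1)[OF 1(2-)])
    qed
    have kk: "k (k' x) = x" "k' (k x) = x" for x using k(1) by (auto simp: homeomorphism_UNIV_iff)
    have contk: "continuous_on UNIV k" "continuous_on UNIV k'" using k(1) by (auto simp: homeomorphism_UNIV_iff)
    have inv_close: "dist (?h' (k' y)) (?h' y) \<le> \<epsilon> / 4" for y
    proof (cases "k' y = y")
      case False
      then have "k (k' y) \<noteq> k' y" using kk by metis
      then obtain z where z: "z \<in> ?h ` C \<union> ?h ` D" "dist z (k' y) < \<delta>" using k(2) by blast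
      have *: "dist y (k' y) < \<delta>" using k(3)[of "k' y"] by (simp add: kk)
      have "norm z \<le> R" using R z(1) by auto
      then have "norm (k' y) \<le> R + 1" using z(2) norm_triangle_sub[of "k' y" z]
        by (simp add: \<delta>_def dist_norm norm_minus_commute)
      moreover from this have "norm y \<le> R + 2" using * norm_triangle_sub[of y "k' y"]
        by (simp add: \<delta>_def dist_norm)
      ultimately show ?thesis
        using \<delta>\<^sub>0(2)[of "k' y" y] * by (simp add: \<delta>_def dist_commute)
    qed (use \<open>\<epsilon> > 0\<close> in simp)
    define f' where "f' x = k (?h x) - x" for x
    define g' where "g' x = ?h' (k' x) - x" for x
    have nf: "norm (f' x - f x) \<le> \<epsilon> / 4" for x
      using k(3)[of "?h x"] by (simp add: f'_def \<delta>_def dist_norm algebra_simps)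
    have ng: "norm (g' x - g x) \<le> \<epsilon> / 4" for x
      using inv_close[of x] by (simp add: g'_def dist_norm algebra_simps)
    have "f' \<in> bcontfun"
    proof (rule bcontfun_normI[where b = "norm f + \<epsilon> / 4"])
      show "continuous_on UNIV f'" unfolding f'_def
        by (intro continuous_intros continuous_on_compose2[OF contk(1)]) auto
      show "norm (f' x) \<le> norm f + \<epsilon> / 4" for x
        using nf[of x] norm_bounded[of f x] norm_triangle_sub[of "f' x" "f x"] by simp
    qed
    then obtain F :: "'a \<Rightarrow>\<^sub>C 'a" where F: "f' = apply_bcontfun F" by (rule bcontfunE)
    have "g' \<in> bcontfun"
    proof (rule bcontfun_normI[where b = "norm g + \<epsilon> / 4"])
      show "continuous_on UNIV g'" unfolding g'_def
        by (intro continuous_intros continuous_on_compose2[OF contk(2)]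
            continuous_on_compose2[OF continuous_on_apply_bcontfun[of UNIV g]]) auto
      show "norm (g' x) \<le> norm g + \<epsilon> / 4" for x
        using ng[of x] norm_bounded[of g x] norm_triangle_sub[of "g' x" "g x"] by simp
    qed
    then obtain G :: "'a \<Rightarrow>\<^sub>C 'a" where G: "g' = apply_bcontfun G" by (rule bcontfunE)
    have FG: "x + F x = k (?h x)" "x + G x = ?h' (k' x)" for x
      by (simp_all add: F[symmetric] G[symmetric] f'_def g'_def)
    show "\<exists>y\<in>bounded_homeos \<inter> separating e C D. dist y p < \<epsilon>"
    proof (intro bexI[of _ "(F, G)"] IntI)
      have "dist F f \<le> \<epsilon> / 4" "dist G g \<le> \<epsilon> / 4"
        by (rule dist_bound, use nf in \<open>simp add: F dist_norm\<close>,
            rule dist_bound, use ng in \<open>simp add: G dist_norm\<close>)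
      then have "dist F f + dist G g < \<epsilon>" using \<open>\<epsilon> > 0\<close> by linarith
      moreover have "dist (F, G) (f, g) \<le> dist F f + dist G g"
        unfolding dist_Pair_Pair by (rule sqrt_sum_squares_le_sum) auto
      ultimately show "dist (F, G) p < \<epsilon>" by simp
      show "(F, G) \<in> bounded_homeos"
        unfolding bounded_homeos_def by (simp only: mem_Collect_eq case_prod_conv FG) (simp only: h1 kk, simp)
      show "(F, G) \<in> separating e C D"
        using k(4) unfolding separating_def by (simp only: mem_Collect_eq case_prod_conv FG image_image)
    qed
  qed
qed

section \<open>The Baire category argument\<close>

lemma exists_separating_homeomorphism:
  fixes e :: "'a::euclidean_space" and I :: "('a set \<times> 'a set) set"
  assumes "norm e = 1" "countable I"
    and "\<And>C D. (C, D) \<in> I \<Longrightarrow> compact C \<and> compact D \<and> C \<inter> D = {} \<and> shrinkable C \<and> shrinkable D"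
  obtains h h' where "homeomorphism UNIV UNIV h h'"
    "\<And>C D. (C, D) \<in> I \<Longrightarrow> (\<lambda>x. e \<bullet> h x) ` C \<inter> (\<lambda>x. e \<bullet> h x) ` D = {}"
proof -
  let ?M = "bounded_homeos :: (('a \<Rightarrow>\<^sub>C 'a) \<times> ('a \<Rightarrow>\<^sub>C 'a)) set"
  \<comment> \<open>Inserting \<open>?M\<close> keeps the intersection inside the space of
    homeomorphisms even when \<open>I\<close> is empty.\<close>
  define \<G> where "\<G> = insert ?M ((\<lambda>(C, D). ?M \<inter> separating e C D) ` I)"
  have "completely_metrizable_space (top_of_set ?M)"
    by (intro completely_metrizable_space_closedin completely_metrizable_space_euclidean)
      (simp add: closed_bounded_homeos)
  moreover have "countable \<G>" using assms(2) by (simp add: \<G>_def)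
  moreover have "openin (top_of_set ?M) T \<and> top_of_set ?M closure_of T = topspace (top_of_set ?M)"
    if T: "T \<in> \<G>" for T
  proof (cases "T = ?M")
    case True
    then show ?thesis by (metis closure_of_topspace openin_subtopology_self topspace_euclidean_subtopology)
  next
    case False
    then obtain C D where CD: "(C, D) \<in> I" "T = ?M \<inter> separating e C D" using T by (auto simp: \<G>_def)
    have "?M \<subseteq> closure T" using dense_separating[OF assms(1)] assms(3)[OF CD(1)] CD(2) by blast
    moreover have "openin (top_of_set ?M) T"
      using open_separating[OF assms(1)] assms(3)[OF CD(1)] CD(2) by (simp add: openin_open_Int)
    ultimately show ?thesis using CD(2) by (auto simp: closure_of_subtopology Int_absorb1)
  qed
  ultimately have "top_of_set ?M closure_of \<Inter>\<G> = topspace (top_of_set ?M)"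
    by (intro Baire_category disjI1)
  moreover have "(0, 0) \<in> ?M" by (simp add: bounded_homeos_def)
  ultimately have "\<Inter>\<G> \<noteq> {}" by (metis closure_of_empty empty_iff topspace_euclidean_subtopology)
  then obtain f g :: "'a \<Rightarrow>\<^sub>C 'a" where fg: "(f, g) \<in> \<Inter>\<G>" by auto
  then have "(f, g) \<in> ?M" by (simp add: \<G>_def)
  then show ?thesis
  proof (intro that[of "\<lambda>x. x + f x" "\<lambda>x. x + g x"] homeomorphism_bounded_homeos)
    fix C D assume "(C, D) \<in> I"
    then have "(f, g) \<in> separating e C D" using fg by (force simp: \<G>_def)
    then show "(\<lambda>x. e \<bullet> (x + f x)) ` C \<inter> (\<lambda>x. e \<bullet> (x + f x)) ` D = {}" by (simp add: separating_def)
  qed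
qed

text \<open>Two distinct points of the union have basic neighbourhoods with disjoint closures.
  Cutting the pieces by such closures gives countably many pairs, and separating the heights of all
  of them is injectivity.\<close>

lemma exists_height_injective_homeomorphism:
  fixes e :: "'a::euclidean_space" and \<K> :: "'a set set"
  assumes "norm e = 1" "countable \<K>" "\<And>C. C \<in> \<K> \<Longrightarrow> compact C \<and> shrinkable C"
  obtains h h' where "homeomorphism UNIV UNIV h h'" "inj_on (\<lambda>x. e \<bullet> h x) (\<Union>\<K>)"
proof -
  obtain \<B> :: "'a set set" where \<B>: "countable \<B>" "topological_basis \<B>"
    using ex_countable_basis by blast
  \<comment> \<open>Disjointness comes from the closures and not from the pieces, so
    \<open>C\<close> and \<open>D\<close> may overlap or coincide.\<close>
  define I where "I = (\<lambda>(C, D, U, V). (C \<inter> closure U, D \<inter> closure V)) `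
      {(C, D, U, V) \<in> \<K> \<times> \<K> \<times> \<B> \<times> \<B>. closure U \<inter> closure V = {}}"
  have "countable (\<K> \<times> \<K> \<times> \<B> \<times> \<B>)" using \<B>(1) assms(2) by blast
  then have "countable I" unfolding I_def by (intro countable_image) (auto intro: countable_subset[rotated])
  moreover have "compact C \<and> compact D \<and> C \<inter> D = {} \<and> shrinkable C \<and> shrinkable D" if CD: "(C, D) \<in> I" for C D
  proof -
    obtain C' D' U V where *: "C' \<in> \<K>" "D' \<in> \<K>" "closure U \<inter> closure V = {}"
      "C = C' \<inter> closure U" "D = D' \<inter> closure V" using CD by (auto simp: I_def)
    then show ?thesis
      using assms(3) by (auto intro: compact_Int_closed shrinkable_subset)
  qed
  ultimately obtain h h' where h: "homeomorphism UNIV UNIV h h'"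
    "\<And>C D. (C, D) \<in> I \<Longrightarrow> (\<lambda>x. e \<bullet> h x) ` C \<inter> (\<lambda>x. e \<bullet> h x) ` D = {}"
    using exists_separating_homeomorphism[OF assms(1), of I] by blast
  have "inj_on (\<lambda>x. e \<bullet> h x) (\<Union>\<K>)"
  proof (rule inj_onI, rule ccontr)
    fix x y assume xy: "x \<in> \<Union>\<K>" "y \<in> \<Union>\<K>" "e \<bullet> h x = e \<bullet> h y" "x \<noteq> y"
    define d where "d = dist x y / 3"
    have "d > 0" using xy(4) by (simp add: d_def)
    obtain U where U: "U \<in> \<B>" "x \<in> U" "U \<subseteq> ball x d"
      using topological_basisE[OF \<B>(2), of "ball x d" x] \<open>d > 0\<close> by auto
    obtain V where V: "V \<in> \<B>" "y \<in> V" "V \<subseteq> ball y d"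
      using topological_basisE[OF \<B>(2), of "ball y d" y] \<open>d > 0\<close> by auto
    have clU: "closure U \<subseteq> cball x d" and clV: "closure V \<subseteq> cball y d"
      by (intro closure_minimal closed_cball order_trans[OF U(3) ball_subset_cball]
          order_trans[OF V(3) ball_subset_cball])+
    have dj: "closure U \<inter> closure V = {}"
    proof (rule ccontr)
      assume "closure U \<inter> closure V \<noteq> {}"
      then obtain z where "z \<in> cball x d" "z \<in> cball y d" using clU clV by blast
      then have "dist x y \<le> 2 * d" using dist_triangle2[of x y z] by (simp add: dist_commute)
      then show False using \<open>d > 0\<close> by (simp add: d_def)
    qed
    obtain C D where CD: "C \<in> \<K>" "x \<in> C" "D \<in> \<K>" "y \<in> D" using xy by blast
    have "(C \<inter> closure U, D \<inter> closure V) \<in> I"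
      unfolding I_def using CD(1,3) U(1) V(1) dj by (intro image_eqI[of _ _ "(C, D, U, V)"]) simp_all
    moreover have "x \<in> C \<inter> closure U" "y \<in> D \<inter> closure V"
      using CD U V closure_subset by blast+
    ultimately show False using h(2) xy(3) by blast
  qed
  then show ?thesis using that h(1) by blast
qed

text \<open>Klee's trick: \<open>K\<close> is the graph of a function of the height, and subtracting a continuous
  extension of its horizontal part shears \<open>K\<close> into the axis.\<close>

lemma straighten_height_injective:
  fixes e :: "'a::euclidean_space"
  assumes "norm e = 1" "compact K" "inj_on (\<lambda>x. e \<bullet> x) K"
  obtains h h' where "homeomorphism UNIV UNIV h h'" "h ` K \<subseteq> span {e}"
proof -
  have "continuous_on K (\<lambda>x. e \<bullet> x)" by (intro continuous_intros)
  \<comment> \<open>By compactness the inverse of the injective height is continuous on a closed set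
    of heights, as Tietze's theorem requires.\<close>
  then obtain k where "homeomorphism K ((\<lambda>x. e \<bullet> x) ` K) (\<lambda>x. e \<bullet> x) k"
    using homeomorphism_compact[OF assms(2) _ refl assms(3)] by blast
  then have k: "continuous_on ((\<lambda>x. e \<bullet> x) ` K) k" "\<And>x. x \<in> K \<Longrightarrow> k (e \<bullet> x) = x"
    by (auto simp: homeomorphism_def)
  have "compact ((\<lambda>x. e \<bullet> x) ` K)" by (intro compact_continuous_image continuous_intros assms(2))
  then have "closedin (top_of_set UNIV) ((\<lambda>x. e \<bullet> x) ` K)" by (simp add: compact_imp_closed)
  then obtain G where G: "continuous_on UNIV G" "\<And>t. t \<in> (\<lambda>x. e \<bullet> x) ` K \<Longrightarrow> G t = k t"
    using Tietze_unbounded[OF k(1)] by blast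
  define H where "H t = G t - (e \<bullet> G t) *\<^sub>R e" for t
  have ee: "e \<bullet> e = 1" using assms(1) by (simp add: dot_square_norm)
  have eH: "e \<bullet> H t = 0" for t by (simp add: H_def inner_diff_right ee)
  have contH: "continuous_on UNIV (\<lambda>x. H (e \<bullet> x))"
    unfolding H_def by (intro continuous_intros continuous_on_compose2[OF G(1)]) auto
  show ?thesis
  proof (rule that)
    show "homeomorphism UNIV UNIV (\<lambda>x. x - H (e \<bullet> x)) (\<lambda>x. x + H (e \<bullet> x))"
      unfolding homeomorphism_UNIV_iff
      by (intro conjI allI continuous_intros contH) (simp_all add: inner_diff_right inner_add_right eH)
    show "(\<lambda>x. x - H (e \<bullet> x)) ` K \<subseteq> span {e}"
    proof clarify
      fix x assume "x \<in> K"
      then have "x - H (e \<bullet> x) = (e \<bullet> x) *\<^sub>R e" using G(2) k(2) by (simp add: H_def)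
      then show "x - H (e \<bullet> x) \<in> span {e}" by (simp add: span_base span_scale)
    qed
  qed
qed

section \<open>Pieces over flat cells\<close>

lemma orthogonal_projection:
  fixes P :: "'a::euclidean_space set"
  assumes "affine P" "P \<noteq> {}"
  shows orthogonal_projection_in: "orthogonal_projection P y \<in> P"
    and orthogonal_projection_orthogonal:
      "w \<in> P \<Longrightarrow> (y - orthogonal_projection P y) \<bullet> (w - orthogonal_projection P y) = 0"
    and continuous_on_orthogonal_projection: "continuous_on S (orthogonal_projection P)"
proof -
  have cl: "closed P" and cv: "convex P" using assms by (auto simp: affine_closed affine_imp_convex)
  have eq: "orthogonal_projection P = closest_point P"
    using orthogonal_projection_eq_closest_point[OF assms] by (rule ext)
  show "continuous_on S (orthogonal_projection P)"
    unfolding eq using cv cl assms(2) by (rule continuous_on_closest_point)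
  let ?c = "orthogonal_projection P y"
  show c: "?c \<in> P" by (simp add: eq assms cl closest_point_in_set)
  show "(y - ?c) \<bullet> (w - ?c) = 0" if w: "w \<in> P"
  proof -
    \<comment> \<open>The reflection of \<open>w\<close> in the foot point also lies in
      \<open>P\<close>. The closest point inequalities for both points together give
      equality.\<close>
    have "2 *\<^sub>R ?c + (- 1) *\<^sub>R w \<in> P" using assms(1) c w by (intro mem_affine) auto
    from closest_point_dot[OF cv cl this, of y] closest_point_dot[OF cv cl w, of y]
    show ?thesis by (simp add: eq inner_diff_right inner_add_right)
  qed
qed

lemma orthogonal_projection_unique:
  fixes P :: "'a::euclidean_space set"
  assumes "affine P" "z \<in> P" "\<And>w. w \<in> P \<Longrightarrow> (y - z) \<bullet> (w - z) = 0"
  shows "orthogonal_projection P y = z"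
proof -
  let ?p = "orthogonal_projection P y"
  have ne: "P \<noteq> {}" using assms(2) by blast
  have "(y - ?p) \<bullet> (z - ?p) = 0" "(y - z) \<bullet> (?p - z) = 0"
    using orthogonal_projection_orthogonal[OF assms(1) ne assms(2)]
      assms(3)[OF orthogonal_projection_in[OF assms(1) ne]] by auto
  then have "(z - ?p) \<bullet> (z - ?p) = 0"
    by (simp add: inner_diff_left inner_diff_right inner_commute)
  then show ?thesis by simp
qed

text \<open>The map applies \<open>h\<close> to the foot point and carries the normal part
  \<open>y - \<pi> y\<close> along unchanged. The second claim says that fibres of the projection go
  to fibres, so whatever lies over a cell is sent over its image.\<close>

lemma homeomorphism_extend_along_projection:
  fixes P :: "'a::euclidean_space set"
  assumes "affine P" "P \<noteq> {}" and h: "homeomorphism P P h h'"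
  defines "\<pi> \<equiv> orthogonal_projection P"
  shows "homeomorphism UNIV UNIV (\<lambda>y. y + (h (\<pi> y) - \<pi> y)) (\<lambda>y. y + (h' (\<pi> y) - \<pi> y))"
    and "\<pi> (y + (h (\<pi> y) - \<pi> y)) = h (\<pi> y)"
proof -
  have \<pi>: "\<pi> y \<in> P" for y unfolding \<pi>_def by (rule orthogonal_projection_in[OF assms(1,2)])
  \<comment> \<open>Stated for a general \<open>k\<close>, since it is applied to \<open>h\<close>
    and to \<open>h'\<close>.\<close>
  have shift: "\<pi> (y + (k (\<pi> y) - \<pi> y)) = k (\<pi> y)" if k: "\<And>z. z \<in> P \<Longrightarrow> k z \<in> P" for k y
    unfolding \<pi>_def
  proof (rule orthogonal_projection_unique[OF assms(1)], fold \<pi>_def)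
    show "k (\<pi> y) \<in> P" using k \<pi> .
    fix w assume "w \<in> P"
    then have "(y - \<pi> y) \<bullet> (w - \<pi> y) = 0" "(y - \<pi> y) \<bullet> (k (\<pi> y) - \<pi> y) = 0"
      unfolding \<pi>_def using orthogonal_projection_orthogonal[OF assms(1,2)] k[OF \<pi>] by (auto simp: \<pi>_def)
    then show "(y + (k (\<pi> y) - \<pi> y) - k (\<pi> y)) \<bullet> (w - k (\<pi> y)) = 0"
      by (simp add: inner_diff_right)
  qed
  have hP: "z \<in> P \<Longrightarrow> h z \<in> P" "z \<in> P \<Longrightarrow> h' z \<in> P" "z \<in> P \<Longrightarrow> h' (h z) = z" "z \<in> P \<Longrightarrow> h (h' z) = z" for z
    using h by (auto simp: homeomorphism_def)
  have cont\<pi>: "continuous_on UNIV \<pi>"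
    unfolding \<pi>_def by (rule continuous_on_orthogonal_projection[OF assms(1,2)])
  have cont: "continuous_on UNIV (\<lambda>y. y + (k (\<pi> y) - \<pi> y))" if "continuous_on P k" for k
    using \<pi> by (intro continuous_intros cont\<pi> continuous_on_compose2[OF that cont\<pi>]) auto
  show "homeomorphism UNIV UNIV (\<lambda>y. y + (h (\<pi> y) - \<pi> y)) (\<lambda>y. y + (h' (\<pi> y) - \<pi> y))"
    unfolding homeomorphism_UNIV_iff
  proof (intro conjI allI)
    show "continuous_on UNIV (\<lambda>y. y + (h (\<pi> y) - \<pi> y))" "continuous_on UNIV (\<lambda>y. y + (h' (\<pi> y) - \<pi> y))"
      using h by (auto intro!: cont simp: homeomorphism_def)
  qed (simp_all add: shift hP \<pi>)
  show "\<pi> (y + (h (\<pi> y) - \<pi> y)) = h (\<pi> y)" using shift hP(1) by blast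
qed

text \<open>An open refinement in which each point has one member is a partition into clopen sets.
  It is made on \<open>K\<close> and only then cut by \<open>A\<close> and mapped by \<phi>, so no
  dimension of the subset or of the image has to be computed; uniform continuity of \<phi> controls
  the diameters.\<close>

lemma zero_dimensional_partition:
  fixes K :: "'a::euclidean_space set" and \<phi> :: "'a \<Rightarrow> 'b::metric_space"
  assumes "compact K" "covering_dim_le (top_of_set K) 0" "continuous_on K \<phi>" "inj_on \<phi> K" "closed A" "\<epsilon> > 0"
  shows "\<exists>\<V>. finite \<V> \<and> disjoint \<V> \<and> \<Union>\<V> = \<phi> ` (K \<inter> A) \<and>
           (\<forall>V\<in>\<V>. compact V \<and> (\<forall>x\<in>V. \<forall>y\<in>V. dist x y < \<epsilon>))"
proof -
  have "uniformly_continuous_on K \<phi>" using assms(1,3) by (intro compact_uniformly_continuous)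
  then obtain \<delta> where \<delta>: "\<delta> > 0" "\<And>x y. x \<in> K \<Longrightarrow> y \<in> K \<Longrightarrow> dist y x < \<delta> \<Longrightarrow> dist (\<phi> y) (\<phi> x) < \<epsilon>"
    using assms(6) unfolding uniformly_continuous_on_def by metis
  obtain k where k: "finite k" "K \<subseteq> (\<Union>x\<in>k. ball x (\<delta> / 2))"
    using assms(1) \<delta>(1) unfolding compact_eq_totally_bounded by (meson half_gt_zero)
  define \<U> where "\<U> = (\<lambda>x. K \<inter> ball x (\<delta> / 2)) ` k"
  have "\<exists>\<V>. finite \<V> \<and> (\<forall>V\<in>\<V>. openin (top_of_set K) V \<and> (\<exists>U\<in>\<U>. V \<subseteq> U)) \<and>
      \<Union>\<V> = topspace (top_of_set K) \<and>
      (\<forall>x\<in>topspace (top_of_set K). int (card {V \<in> \<V>. x \<in> V}) \<le> 0 + 1)"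
  proof (rule assms(2)[unfolded covering_dim_le_def, rule_format], intro conjI ballI)
    show "\<Union>\<U> = topspace (top_of_set K)" using k(2) by (auto simp: \<U>_def)
  qed (use k(1) in \<open>auto simp: \<U>_def openin_open_Int\<close>)
  then obtain \<W> where \<W>: "finite \<W>" "\<forall>W\<in>\<W>. openin (top_of_set K) W \<and> (\<exists>U\<in>\<U>. W \<subseteq> U)"
      "\<Union>\<W> = K" "\<forall>x\<in>K. int (card {W \<in> \<W>. x \<in> W}) \<le> 0 + 1"
    by (elim exE conjE) (simp only: topspace_euclidean_subtopology)
  have dj: "U \<inter> V = {}" if UV: "U \<in> \<W>" "V \<in> \<W>" "U \<noteq> V" for U V
  proof (rule ccontr)
    assume "U \<inter> V \<noteq> {}"
    then obtain x where x: "x \<in> U" "x \<in> V" by blast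
    then have "card {U, V} \<le> card {W \<in> \<W>. x \<in> W}" using UV \<W>(1) by (intro card_mono) auto
    moreover have "x \<in> K" using x UV \<W>(3) by blast
    ultimately have "card {U, V} \<le> 1" using \<W>(4) by fastforce
    then show False using UV(3) by simp
  qed
  have sub: "W \<subseteq> K" if "W \<in> \<W>" for W using that \<W>(3) by blast
  \<comment> \<open>The complement of a member in \<open>K\<close> is the union of the other
    members, hence relatively open.\<close>
  have cpt: "compact W" if W: "W \<in> \<W>" for W
  proof -
    have "openin (top_of_set K) (\<Union>(\<W> - {W}))" using \<W>(2) by (intro openin_Union) auto
    then have "closedin (top_of_set K) (K - \<Union>(\<W> - {W}))"
      using closedin_diff[OF closedin_topspace, of "top_of_set K"] by simp
    moreover have "K - \<Union>(\<W> - {W}) = W" using \<W>(3) dj W by blast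
    ultimately show ?thesis using assms(1) closedin_compact by metis
  qed
  show ?thesis
  proof (intro exI[of _ "(\<lambda>W. \<phi> ` (W \<inter> A)) ` \<W>"] conjI ballI)
    show "finite ((\<lambda>W. \<phi> ` (W \<inter> A)) ` \<W>)" using \<W>(1) by simp
    show "\<Union> ((\<lambda>W. \<phi> ` (W \<inter> A)) ` \<W>) = \<phi> ` (K \<inter> A)" using \<W>(3) by blast
    show "disjoint ((\<lambda>W. \<phi> ` (W \<inter> A)) ` \<W>)"
    proof (rule pairwiseI)
      fix B C assume "B \<in> (\<lambda>W. \<phi> ` (W \<inter> A)) ` \<W>" "C \<in> (\<lambda>W. \<phi> ` (W \<inter> A)) ` \<W>" "B \<noteq> C"
      then obtain U V where UV: "U \<in> \<W>" "V \<in> \<W>" "U \<noteq> V" "B = \<phi> ` (U \<inter> A)" "C = \<phi> ` (V \<inter> A)" by blast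
      have "\<phi> ` (U \<inter> A) \<inter> \<phi> ` (V \<inter> A) = \<phi> ` ((U \<inter> A) \<inter> (V \<inter> A))"
        using sub[OF UV(1)] sub[OF UV(2)] by (intro inj_on_image_Int[OF assms(4), symmetric]) auto
      also have "(U \<inter> A) \<inter> (V \<inter> A) = {}" using dj[OF UV(1-3)] by blast
      finally show "disjnt B C" using UV(4,5) by (simp add: disjnt_def)
    qed
    fix V assume "V \<in> (\<lambda>W. \<phi> ` (W \<inter> A)) ` \<W>"
    then obtain W where W: "W \<in> \<W>" "V = \<phi> ` (W \<inter> A)" by blast
    have "continuous_on (W \<inter> A) \<phi>" using sub[OF W(1)] by (intro continuous_on_subset[OF assms(3)]) blast
    then show "compact V" unfolding W(2)
      using cpt[OF W(1)] assms(5) by (intro compact_continuous_image compact_Int_closed)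
    fix x y assume "x \<in> V" "y \<in> V"
    then obtain x' y' where xy: "x' \<in> W" "y' \<in> W" "x = \<phi> x'" "y = \<phi> y'" using W(2) by blast
    obtain z where "W \<subseteq> ball z (\<delta> / 2)" using \<W>(2) W(1) by (fastforce simp: \<U>_def)
    then have "dist z x' < \<delta> / 2" "dist z y' < \<delta> / 2" using xy by auto
    then have "dist x' y' < \<delta>" using dist_triangle3[of x' y' z] by simp
    then show "dist x y < \<epsilon>" using \<delta>(2)[of y' x'] sub[OF W(1)] xy by blast
  qed
qed

text \<open>The plane has a direction orthogonal to the straightened cell, because the simplex has
  smaller dimension. Projection to the plane preserves the component in that direction, so
  everything over the simplex lies in one hyperplane of the whole space; shrinkability obtained
  there is carried back by the inverse homeomorphism.\<close>

lemma preimage_of_flat_cell_shrinkable: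
  fixes K P :: "'a::euclidean_space set"
  assumes "compact K" "covering_dim_le (top_of_set K) 0"
    and P: "affine P" "aff_dim P = int m"
    and X: "flat_cell_in P X" "covering_dim_le (top_of_set X) (int m - 1)"
  shows "compact (K \<inter> orthogonal_projection P -` X)"
    and "shrinkable (K \<inter> orthogonal_projection P -` X)"
proof -
  obtain k h h' where XP: "X \<subseteq> P" and h: "homeomorphism P P h h'" and simpX: "int k simplex h ` X"
    using X(1) unfolding flat_cell_in_def by blast
  have "P \<noteq> {}" using P(2) by auto
  note P' = P(1) \<open>P \<noteq> {}\<close>
  define \<pi> where "\<pi> = orthogonal_projection P"
  define T where "T = h ` X"
  have homXT: "homeomorphism X T h h'"
    unfolding T_def using h XP by (rule homeomorphism_of_subsets) (use h XP in \<open>auto simp: homeomorphism_def\<close>)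
  have TP: "T \<subseteq> P" using h XP by (auto simp: T_def homeomorphism_def)
  have simpT: "int k simplex T" using simpX by (simp add: T_def)
  have "aff_dim T = int k" using simpT by (rule aff_dim_simplex)
  then have "k \<le> m" using aff_dim_subset[OF TP] P(2) by simp
  \<comment> \<open>For \<open>k = m\<close> the covering dimension of \<open>X\<close> would exceed
    \<open>m - 1\<close>.\<close>
  moreover have "k \<noteq> m" using simplex_covering_dim_ge[OF homXT] simpT X(2) by blast
  ultimately have "k < m" by simp
  have "T \<noteq> {}" using \<open>aff_dim T = int k\<close> by auto
  then obtain a where a: "a \<in> T" by blast
  then have "a \<in> P" using TP by blast
  let ?T = "(\<lambda>x. - a + x) ` T" and ?P = "(\<lambda>x. - a + x) ` P"
  have subP: "subspace ?P" using affine_diffs_subspace[OF P(1) \<open>a \<in> P\<close>] .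
  have "dim ?T = k" "dim ?P = m"
    using aff_dim_eq_dim[of a T] aff_dim_eq_dim[of a P] a \<open>a \<in> P\<close> \<open>aff_dim T = int k\<close> P(2)
    by (simp_all add: hull_inc)
  then have "span ?T \<noteq> span ?P" using \<open>k < m\<close> by (metis dim_span less_irrefl)
  moreover have "span ?T \<subseteq> span ?P" using TP by (intro span_mono) blast
  ultimately obtain v where v: "v \<noteq> 0" "v \<in> span ?P" "\<And>y. y \<in> span ?T \<Longrightarrow> orthogonal v y"
    using orthogonal_to_subspace_exists_gen[of ?T ?P] by blast
  have "v \<in> ?P" using v(2) unfolding span_eq_iff[THEN iffD2, OF subP] .
  then have avP: "a + v \<in> P" by auto
  define e where "e = v /\<^sub>R norm v"
  have e1: "norm e = 1" using v(1) by (simp add: e_def)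
  have ev: "e \<bullet> x = (v \<bullet> x) / norm v" for x by (simp add: e_def divide_inverse_commute)
  have hyper: "e \<bullet> y = e \<bullet> a" if "\<pi> y \<in> T" for y
  proof -
    have "v \<bullet> (- a + \<pi> y) = 0" using v(3)[of "- a + \<pi> y"] that by (auto simp: orthogonal_def intro: span_base)
    \<comment> \<open>\<open>a\<close> and \<open>a + v\<close> both lie in \<open>P\<close>; the
      difference of the two equations shows that \<open>v\<close> is orthogonal to the normal part
      of \<open>y\<close>.\<close>
    moreover have "(y - \<pi> y) \<bullet> (a + v - \<pi> y) = 0" "(y - \<pi> y) \<bullet> (a - \<pi> y) = 0"
      unfolding \<pi>_def using orthogonal_projection_orthogonal[OF P'] avP \<open>a \<in> P\<close> by blast+
    then have "v \<bullet> (y - \<pi> y) = 0"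
      by (simp add: inner_diff_right inner_add_right inner_commute)
    ultimately have "v \<bullet> y = v \<bullet> a" by (simp add: inner_diff_right inner_add_right)
    then show ?thesis by (simp add: ev)
  qed
  have "compact X" using homXT compact_simplex[OF simpT] by (metis compact_continuous_image homeomorphism_def)
  have "continuous_on UNIV \<pi>" unfolding \<pi>_def by (rule continuous_on_orthogonal_projection[OF P'])
  then have clA: "closed (\<pi> -` X)"
    using \<open>compact X\<close> by (simp add: compact_imp_closed continuous_on_closed_vimage)
  then have cpt: "compact (K \<inter> \<pi> -` X)" using assms(1) by blast
  then show "compact (K \<inter> orthogonal_projection P -` X)" by (simp add: \<pi>_def)
  define \<phi> where "\<phi> y = y + (h (\<pi> y) - \<pi> y)" for y
  define \<phi>' where "\<phi>' y = y + (h' (\<pi> y) - \<pi> y)" for y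
  have \<phi>: "homeomorphism UNIV UNIV \<phi> \<phi>'" and \<pi>\<phi>: "\<pi> (\<phi> y) = h (\<pi> y)" for y
    unfolding \<phi>_def \<phi>'_def \<pi>_def using homeomorphism_extend_along_projection[OF P' h] by blast+
  then have \<phi>c: "continuous_on UNIV \<phi>" and \<phi>inv: "\<phi>' (\<phi> y) = y" for y
    by (auto simp: homeomorphism_UNIV_iff)
  have inj: "inj_on \<phi> K" by (rule inj_on_inverseI) (rule \<phi>inv)
  have "shrinkable (\<phi> ` (K \<inter> \<pi> -` X))"
  proof (rule shrinkable_zero_dimensional_in_hyperplane[OF e1])
    show "e \<bullet> x = e \<bullet> a" if "x \<in> \<phi> ` (K \<inter> \<pi> -` X)" for x
      using that by (auto intro!: hyper simp: \<pi>\<phi> T_def)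
    show "\<exists>\<V>. finite \<V> \<and> disjoint \<V> \<and> \<Union>\<V> = \<phi> ` (K \<inter> \<pi> -` X) \<and>
           (\<forall>V\<in>\<V>. compact V \<and> (\<forall>x\<in>V. \<forall>y\<in>V. dist x y < \<epsilon>))" if "\<epsilon> > 0" for \<epsilon>
      using assms(1,2) continuous_on_subset[OF \<phi>c subset_UNIV] inj clA that
      by (rule zero_dimensional_partition)
  qed
  then have "shrinkable (\<phi>' ` \<phi> ` (K \<inter> \<pi> -` X))"
  proof (rule shrinkable_homeomorphic_image[OF _ _ homeomorphism_symD[OF \<phi>]])
    show "compact (\<phi> ` (K \<inter> \<pi> -` X))"
      using cpt continuous_on_subset[OF \<phi>c subset_UNIV] by (intro compact_continuous_image)
  qed
  then show "shrinkable (K \<inter> orthogonal_projection P -` X)" by (simp add: image_image \<phi>inv \<pi>_def)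
qed

section \<open>From the pieces to the whole set\<close>

text \<open>A generic homeomorphism followed by a shear along the axis. Compactness of the union is
  used for the shear, which extends a function from the set of all heights of the union.\<close>

lemma countable_union_of_shrinkable_straightens:
  fixes \<K> :: "'a::euclidean_space set set"
  assumes "countable \<K>" "\<And>C. C \<in> \<K> \<Longrightarrow> compact C \<and> shrinkable C" "compact (\<Union>\<K>)"
  obtains h h' L where "homeomorphism (UNIV :: 'a set) (UNIV :: 'a set) h h'" "affine L" "aff_dim L = 1" "h ` (\<Union>\<K>) \<subseteq> L"
proof -
  obtain e :: 'a where "e \<in> Basis" using nonempty_Basis by blast
  then have e: "norm e = 1" "e \<noteq> 0" by auto
  obtain g g' where g: "homeomorphism UNIV UNIV g g'" "inj_on (\<lambda>x. e \<bullet> g x) (\<Union>\<K>)"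
    using exists_height_injective_homeomorphism[OF e(1) assms(1,2)] by metis
  have "continuous_on (\<Union>\<K>) g" using g(1) by (meson continuous_on_subset homeomorphism_UNIV_iff subset_UNIV)
  then have "compact (g ` \<Union>\<K>)" using assms(3) by (rule compact_continuous_image)
  moreover have "inj_on (\<lambda>x. e \<bullet> x) (g ` \<Union>\<K>)"
    using g(2) by (force simp: inj_on_def)
  ultimately obtain k k' where k: "homeomorphism UNIV UNIV k k'" "k ` g ` \<Union>\<K> \<subseteq> span {e}"
    using straighten_height_injective[OF e(1)] by metis
  show ?thesis
  proof (rule that)
    show "homeomorphism UNIV UNIV (k \<circ> g) (g' \<circ> k')" using g(1) k(1) by (rule homeomorphism_compose)
    show "affine (span {e})" by (simp add: subspace_imp_affine)
    show "aff_dim (span {e}) = 1" using e(2) by (simp add: aff_dim_subspace)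
    show "(k \<circ> g) ` \<Union>\<K> \<subseteq> span {e}" using k(2) by (simp add: image_comp)
  qed
qed

theorem mainTheorem7:
  fixes K P :: "(real ^ 'n) set" and m :: nat and \<X> :: "(real ^ 'n) set set"
  assumes "CARD('n) \<ge> 3"
    and "compact K" and "covering_dim (top_of_set K) = 0"
    and "1 \<le> m" and "m \<le> CARD('n)"
    and "affine P" and "aff_dim P = int m"
    and "countable \<X>"
    and "\<And>X. X \<in> \<X> \<Longrightarrow> flat_cell_in P X"
    and "\<And>X. X \<in> \<X> \<Longrightarrow> covering_dim (top_of_set X) \<le> ereal (real m - 1)"
    and "orthogonal_projection P ` K \<subseteq> \<Union>\<X>"
  shows "tame K"
proof -
  have K0: "covering_dim_le (top_of_set K) 0"
    using assms(3) covering_dim_le_iff[of 0 "top_of_set K"] by simp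
  define \<K> where "\<K> = (\<lambda>X. K \<inter> orthogonal_projection P -` X) ` \<X>"
  have pieces: "compact C \<and> shrinkable C" if C: "C \<in> \<K>" for C
  proof -
    obtain X where X: "X \<in> \<X>" "C = K \<inter> orthogonal_projection P -` X" using C by (auto simp: \<K>_def)
    have "covering_dim_le (top_of_set X) (int m - 1)"
      using assms(10)[OF X(1)] covering_dim_le_iff[of "int m - 1" "top_of_set X"] by simp
    then show ?thesis
      using preimage_of_flat_cell_shrinkable[OF assms(2) K0 assms(6,7) assms(9)[OF X(1)]] X(2) by blast
  qed
  have "countable \<K>" using assms(8) by (simp add: \<K>_def)
  have "\<Union>\<K> = K" using assms(11) by (auto simp: \<K>_def)
  obtain h h' L where "homeomorphism (UNIV :: (real ^ 'n) set) (UNIV :: (real ^ 'n) set) h h'" "affine L" "aff_dim L = 1" "h ` \<Union>\<K> \<subseteq> L"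
    using countable_union_of_shrinkable_straightens[OF \<open>countable \<K>\<close> pieces] \<open>\<Union>\<K> = K\<close> assms(2) by metis
  then show ?thesis
    unfolding tame_def using assms(2,3) \<open>\<Union>\<K> = K\<close> by metis
qed

end
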